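(* Let, for some $\lambda_0>0$ and $\varepsilon_0>0$, the representation $$F(\lambda)=\bigcup_{n=1}^N F_n(\lambda),\qquad F_n(\lambda)\cap F_m(\lambda)=\emptyset\ \text{ for } n\ne m,$$ hold for $\lambda=\lambda_0+\varepsilon_0$. Suppose that for all $n=1,\dots,N$ there exist points $x_n\in F_n(\lambda_0)$ such that the estimates $$\langle x-x_n,\nabla v(x)\rangle\le c_0\,v(x),\qquad x\in F_n(\lambda_0),$$ are satisfied with some constant $c_0>0$. Then $$U(\psi_\hbar)=\int_{\mathbb{R}^d}v(x)\psi_\hbar^2(x)\,dx\ge c\,\lambda_\hbar$$ for all $\lambda_\hbar\in(\lambda_0-\varepsilon_0/2,\lambda_0+\varepsilon_0/2)$, an arbitrary $c<2(c_0+2)^{-1}$ and sufficiently small $\hbar$.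
   Context: $H_\hbar=-\hbar^2\Delta+v(x)$, $\hbar>0$, is the Schrödinger operator in $L_2(\mathbb{R}^d)$, where $v\in C^\infty(\mathbb{R}^d)$ is real-valued, $\min_{x\in\mathbb{R}^d}v(x)=0$ and $v_\infty:=\liminf_{|x|\to\infty}v(x)>0$. The energy $\lambda_0$ lies in $(0,v_\infty)$ and is non-critical, that is, $\nabla v(x)\ne0$ for all $x$ with $v(x)=\lambda_0$. $\psi_\hbar$ is a real eigenfunction of $H_\hbar$ with eigenvalue $\lambda_\hbar$: $-\hbar^2\Delta\psi_\hbar+v\psi_\hbar=\lambda_\hbar\psi_\hbar$, $\psi_\hbar\in L_2(\mathbb{R}^d)$, normalized by $\int_{\mathbb{R}^d}\psi_\hbar^2dx=1$. For $\lambda\in\mathbb{R}$, $F(\lambda)=\{x\in\mathbb{R}^d:v(x)<\lambda\}$. The sets $F_n(\lambda)$ are the potential wells for the energy $\lambda$; $F_n(\lambda_0)$ is the part of $F(\lambda_0)$ lying in $F_n(\lambda_0+\varepsilon_0)$. $\langle\cdot,\cdot\rangle$ is the Euclidean scalar product.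
   Formalization: The bound is proved for λ_ħ in the stated window with also λ_ħ<λ_0+ε, where ε>0 depends on c: the full upper half fails since the estimate is assumed only where v<λ_0. Wells F_n are taken open, ψ_ħ as a C² solution. *)

theory Defs
  imports "HOL-Analysis.Analysis"
begin

definition partial_deriv :: "'a::euclidean_space \<Rightarrow> ('a \<Rightarrow> real) \<Rightarrow> 'a \<Rightarrow> real" where
  "partial_deriv b f x = frechet_derivative f (at x) b"

definition grad :: "('a::euclidean_space \<Rightarrow> real) \<Rightarrow> 'a \<Rightarrow> 'a" where
  "grad f x = (\<Sum>b\<in>Basis. partial_deriv b f x *\<^sub>R b)"

definition laplacian :: "('a::euclidean_space \<Rightarrow> real) \<Rightarrow> 'a \<Rightarrow> real" where
  "laplacian f x = (\<Sum>b\<in>Basis. partial_deriv b (partial_deriv b f) x)"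

fun C_k :: "nat \<Rightarrow> ('a::euclidean_space \<Rightarrow> real) \<Rightarrow> bool" where
  "C_k 0 f \<longleftrightarrow> continuous_on UNIV f"
| "C_k (Suc k) f \<longleftrightarrow> f differentiable_on UNIV \<and> (\<forall>b\<in>Basis. C_k k (partial_deriv b f))"

definition C_infinity :: "('a::euclidean_space \<Rightarrow> real) \<Rightarrow> bool" where
  "C_infinity f \<longleftrightarrow> (\<forall>k. C_k k f)"

text \<open>The value is an extended real, so that confining potentials (value \<open>\<infinity>\<close>) are included.\<close>

definition v_infty :: "('a::euclidean_space \<Rightarrow> real) \<Rightarrow> ereal" where
  "v_infty v = Liminf at_infinity (\<lambda>x. ereal (v x))"

definition sublevel :: "('a \<Rightarrow> real) \<Rightarrow> real \<Rightarrow> 'a set" where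
  "sublevel v E = {x. v x < E}"

definition noncritical :: "('a::euclidean_space \<Rightarrow> real) \<Rightarrow> real \<Rightarrow> bool" where
  "noncritical v E \<longleftrightarrow> (\<forall>x. v x = E \<longrightarrow> grad v x \<noteq> 0)"

text \<open>
  Since \<open>v\<close> is smooth, every \<open>L\<^sub>2\<close> eigenfunction has a smooth representative by elliptic
  regularity, so the eigenvalue equation is imposed pointwise on a \<open>C\<^sup>2\<close> function.  Conversely,
  for \<open>v \<ge> 0\<close> the operator is essentially self-adjoint on the smooth compactly supported
  functions, so such a \<open>\<psi>\<close> automatically lies in the domain of the self-adjoint operator.
\<close>

definition normalized_eigenfunction ::
    "('a::euclidean_space \<Rightarrow> real) \<Rightarrow> real \<Rightarrow> real \<Rightarrow> ('a \<Rightarrow> real) \<Rightarrow> bool" where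
  "normalized_eigenfunction v h E \<psi> \<longleftrightarrow>
     C_k 2 \<psi> \<and>
     (\<forall>x. - h\<^sup>2 * laplacian \<psi> x + v x * \<psi> x = E * \<psi> x) \<and>
     integrable lborel (\<lambda>x. (\<psi> x)\<^sup>2) \<and>
     (\<integral>x. (\<psi> x)\<^sup>2 \<partial>lborel) = 1"

definition potential_energy :: "('a::euclidean_space \<Rightarrow> real) \<Rightarrow> ('a \<Rightarrow> real) \<Rightarrow> real" where
  "potential_energy v \<psi> = (\<integral>x. v x * (\<psi> x)\<^sup>2 \<partial>lborel)"

end

theory Submission
  imports Defs
begin

text \<open>
  The virial identity is applied to the field \<open>X = F \<xi>\<close>, where \<open>\<xi> x = x - p n\<close> on the well \<open>W n\<close>,
  so that \<open>D \<xi>\<close> is the identity, and \<open>F\<close> is a function of \<open>v\<close> that cuts off at energies slightly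
  above \<open>E\<^sub>0\<close>.  Compactness and non-criticality of \<open>E\<^sub>0\<close> extend the hypothesis on \<open>\<xi> \<bullet> grad v\<close>
  to these energies with \<open>c\<^sub>0\<close> replaced by \<open>c\<^sub>0 + \<gamma>\<close>.  Hence twice the kinetic energy of \<open>\<psi>\<close>
  below the cutoff is at most \<open>(c\<^sub>0 + \<gamma>) U\<close>, where \<open>U\<close> is the potential energy, up to errors
  supported in the shell where \<open>grad F\<close> does not vanish.  There \<open>v \<ge> E\<close>, so that the energy
  density \<open>h\<^sup>2 \<bar>grad \<psi>\<bar>\<^sup>2 + (v - E) \<psi>\<^sup>2\<close> is nonnegative, \<open>\<psi>\<^sup>2 \<le> v \<psi>\<^sup>2 / E\<^sub>0\<close>, and a
  Caccioppoli estimate bounds \<open>\<integral> \<bar>grad \<psi>\<bar>\<^sup>2\<close> by \<open>C U\<close>.  The error is therefore at most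
  \<open>C h\<^sup>2 U\<close>; being relative to \<open>U\<close>, it is harmless even when \<open>E\<close> is close to \<open>0\<close>.
\<close>

section \<open>Symmetry of second derivatives\<close>

lemma has_real_derivative_along_line:
  fixes f :: "'a::real_normed_vector \<Rightarrow> real"
  assumes "(f has_derivative f') (at (x + t *\<^sub>R u))"
  shows "((\<lambda>t. f (x + t *\<^sub>R u)) has_real_derivative f' u) (at t)"
proof -
  have line: "((\<lambda>t. x + t *\<^sub>R u) has_derivative (\<lambda>s. s *\<^sub>R u)) (at t)"
    by (auto intro!: derivative_eq_intros)
  have "(\<lambda>s. f' (s *\<^sub>R u)) = (*) (f' u)"
    using linear_scale[OF has_derivative_linear[OF assms]] by (simp add: fun_eq_iff mult.commute)
  with has_derivative_compose[OF line assms] show ?thesis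
    by (simp add: has_field_derivative_def)
qed

lemma mean_value_along_line:
  fixes f :: "'a::real_normed_vector \<Rightarrow> real"
  assumes "\<And>x. (f has_derivative f' x) (at x)" and "0 < h"
  obtains t where "0 < t" "t < h" "f (x + h *\<^sub>R u) - f x = h * f' (x + t *\<^sub>R u) u"
  using MVT2[OF \<open>0 < h\<close> has_real_derivative_along_line[OF assms(1)], of x u] by auto

lemma second_difference_mean_value:
  fixes f :: "'a::real_normed_vector \<Rightarrow> real"
  assumes f: "\<And>x. (f has_derivative f' x) (at x)"
    and f'_u: "\<And>x. ((\<lambda>x. f' x u) has_derivative f'' x) (at x)"
    and "0 < h"
  obtains y where "dist y x \<le> h * (norm u + norm w)"
    and "f (x + h *\<^sub>R u + h *\<^sub>R w) - f (x + h *\<^sub>R u) - f (x + h *\<^sub>R w) + f x = h * h * f'' y w"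
proof -
  define g where "g y = f (y + h *\<^sub>R w) - f y" for y
  have "(g has_derivative (\<lambda>k. f' (y + h *\<^sub>R w) k - f' y k)) (at y)" for y
    unfolding g_def
    by (intro has_derivative_diff f has_derivative_compose[OF _ f, of _ "\<lambda>k. k", simplified])
       (auto intro!: derivative_eq_intros)
  from mean_value_along_line[OF this \<open>0 < h\<close>] obtain s where s: "0 < s" "s < h"
    "g (x + h *\<^sub>R u) - g x = h * (f' (x + s *\<^sub>R u + h *\<^sub>R w) u - f' (x + s *\<^sub>R u) u)"
    by blast
  obtain t where t: "0 < t" "t < h"
    "f' (x + s *\<^sub>R u + h *\<^sub>R w) u - f' (x + s *\<^sub>R u) u = h * f'' (x + s *\<^sub>R u + t *\<^sub>R w) w"
    using mean_value_along_line[OF f'_u \<open>0 < h\<close>] by blast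
  show ?thesis
  proof
    have "dist (x + s *\<^sub>R u + t *\<^sub>R w) x \<le> norm (s *\<^sub>R u) + norm (t *\<^sub>R w)"
      by (simp add: dist_norm add.assoc norm_triangle_ineq del: norm_scaleR)
    also have "\<dots> \<le> h * norm u + h * norm w"
      using s t by (intro add_mono) (auto intro: mult_right_mono)
    finally show "dist (x + s *\<^sub>R u + t *\<^sub>R w) x \<le> h * (norm u + norm w)"
      by (simp add: distrib_left)
    show "f (x + h *\<^sub>R u + h *\<^sub>R w) - f (x + h *\<^sub>R u) - f (x + h *\<^sub>R w) + f x
        = h * h * f'' (x + s *\<^sub>R u + t *\<^sub>R w) w"
      using s(3) t(3) by (simp add: g_def)
  qed
qed

lemma second_derivative_symmetric:
  fixes f :: "'a::real_normed_vector \<Rightarrow> real"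
  assumes f: "\<And>x. (f has_derivative f' x) (at x)"
    and f'_u: "\<And>x. ((\<lambda>x. f' x u) has_derivative f\<^sub>u x) (at x)"
    and f'_w: "\<And>x. ((\<lambda>x. f' x w) has_derivative f\<^sub>w x) (at x)"
    and cont: "isCont (\<lambda>x. f\<^sub>u x w) x" "isCont (\<lambda>x. f\<^sub>w x u) x"
  shows "f\<^sub>u x w = f\<^sub>w x u"
proof -
  define h where "h n = inverse (real (Suc n))" for n
  have h_pos: "0 < h n" for n
    by (simp add: h_def)
  have "\<exists>y z. dist y x \<le> h n * (norm u + norm w) \<and> dist z x \<le> h n * (norm u + norm w)
      \<and> f\<^sub>u y w = f\<^sub>w z u" for n
  proof -
    obtain y where y: "dist y x \<le> h n * (norm u + norm w)"
      "f (x + h n *\<^sub>R u + h n *\<^sub>R w) - f (x + h n *\<^sub>R u) - f (x + h n *\<^sub>R w) + f x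
        = h n * h n * f\<^sub>u y w"
      using second_difference_mean_value[OF f f'_u h_pos] by blast
    obtain z where z: "dist z x \<le> h n * (norm w + norm u)"
      "f (x + h n *\<^sub>R w + h n *\<^sub>R u) - f (x + h n *\<^sub>R w) - f (x + h n *\<^sub>R u) + f x
        = h n * h n * f\<^sub>w z u"
      using second_difference_mean_value[OF f f'_w h_pos] by blast
    have "f (x + h n *\<^sub>R w + h n *\<^sub>R u) = f (x + h n *\<^sub>R u + h n *\<^sub>R w)"
      by (simp add: add_ac)
    with y(2) z(2) have "h n * h n * f\<^sub>u y w = h n * h n * f\<^sub>w z u"
      by linarith
    with y(1) z(1) h_pos[of n] show ?thesis
      by (auto simp: add.commute)
  qed
  then obtain y z where near: "\<And>n. dist (y n) x \<le> h n * (norm u + norm w)"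
      "\<And>n. dist (z n) x \<le> h n * (norm u + norm w)"
    and eq: "\<And>n. f\<^sub>u (y n) w = f\<^sub>w (z n) u"
    by metis
  have bound_lim: "(\<lambda>n. h n * (norm u + norm w)) \<longlonglongrightarrow> 0"
    unfolding h_def by (rule tendsto_mult_left_zero[OF LIMSEQ_inverse_real_of_nat])
  have "y \<longlonglongrightarrow> x" "z \<longlonglongrightarrow> x"
    by (rule metric_tendsto_imp_tendsto[OF bound_lim];
        simp add: order_trans[OF near(1) abs_ge_self] order_trans[OF near(2) abs_ge_self])+
  then have "(\<lambda>n. f\<^sub>u (y n) w) \<longlonglongrightarrow> f\<^sub>u x w" "(\<lambda>n. f\<^sub>w (z n) u) \<longlonglongrightarrow> f\<^sub>w x u"
    using cont by (auto intro: isCont_tendsto_compose)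
  then show ?thesis
    unfolding eq by (rule LIMSEQ_unique)
qed

section \<open>The divergence theorem for compactly supported fields\<close>

definition compactly_supported :: "('a::euclidean_space \<Rightarrow> 'b::zero) \<Rightarrow> bool" where
  "compactly_supported f \<longleftrightarrow> bounded {x. f x \<noteq> 0}"

lemma compactly_supported_subset:
  assumes "compactly_supported f" and "\<And>x. f x = 0 \<Longrightarrow> g x = 0"
  shows "compactly_supported g"
  using assms unfolding compactly_supported_def by (auto elim!: bounded_subset)

lemma compactly_supportedI:
  assumes "compact K" and "\<And>x. x \<notin> K \<Longrightarrow> f x = 0"
  shows "compactly_supported f"
  unfolding compactly_supported_def
  using assms by (auto intro: bounded_subset[OF compact_imp_bounded])

lemma compactly_supportedE:
  assumes "compactly_supported f"
  obtains r where "\<And>x. r < norm x \<Longrightarrow> f x = 0"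
proof -
  obtain r where "\<And>x. f x \<noteq> 0 \<Longrightarrow> norm x \<le> r"
    using assms unfolding compactly_supported_def bounded_iff by auto
  then show ?thesis
    by (intro that[of r]) force
qed

lemma compactly_supported_derivative:
  assumes "compactly_supported f" and f: "\<And>x. (f has_derivative f' x) (at x)"
  shows "compactly_supported (\<lambda>x. f' x (z x))"
proof -
  obtain r where r: "\<And>x. r < norm x \<Longrightarrow> f x = 0"
    using compactly_supportedE[OF assms(1)] by metis
  have "f' x = (\<lambda>_. 0)" if "x \<notin> cball 0 r" for x
  proof (rule has_derivative_unique[OF f])
    show "(f has_derivative (\<lambda>_. 0)) (at x)"
      by (rule has_derivative_transform_within_open[OF has_derivative_const, of "- cball 0 r"])
         (use that in \<open>auto simp: r\<close>)
  qed
  then show ?thesis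
    by (intro compactly_supportedI[of "cball 0 r"]) simp_all
qed

lemma integrable_compactly_supported:
  fixes f :: "'a::euclidean_space \<Rightarrow> real"
  assumes "compactly_supported f" and "continuous_on UNIV f"
  shows "integrable lborel f"
proof -
  obtain r where r: "\<And>x. r < norm x \<Longrightarrow> f x = 0"
    using compactly_supportedE[OF assms(1)] by metis
  have "integrable lborel (\<lambda>x. indicator (cball 0 r) x *\<^sub>R f x)"
    using assms(2) by (intro borel_integrable_compact) (auto intro: continuous_on_subset)
  also have "(\<lambda>x. indicator (cball 0 r) x *\<^sub>R f x) = f"
    using r by (fastforce simp: indicator_def)
  finally show ?thesis .
qed

lemma integrable_compactly_supported_mult:
  fixes \<rho> f :: "'a::euclidean_space \<Rightarrow> real"
  assumes "compactly_supported \<rho>" and "continuous_on UNIV \<rho>" and "continuous_on UNIV f"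
  shows "integrable lborel (\<lambda>x. \<rho> x * f x)"
  by (intro integrable_compactly_supported compactly_supported_subset[OF assms(1)]
      continuous_intros assms) simp

lemma bounded_compactly_supported:
  fixes f :: "'a::euclidean_space \<Rightarrow> real"
  assumes "compactly_supported f" and "continuous_on UNIV f"
  obtains B where "\<And>x. \<bar>f x\<bar> \<le> B"
proof -
  obtain r where r: "\<And>x. r < norm x \<Longrightarrow> f x = 0"
    using compactly_supportedE[OF assms(1)] by metis
  have "bounded (f ` cball 0 r)"
    using assms(2) by (intro compact_imp_bounded compact_continuous_image)
      (auto intro: continuous_on_subset)
  then obtain B where "0 < B" and B: "\<forall>y\<in>f ` cball 0 r. norm y \<le> B"
    unfolding bounded_pos by blast
  have "\<bar>f x\<bar> \<le> B" for x
    using B r[of x] \<open>0 < B\<close> by (cases "r < norm x") auto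
  then show ?thesis
    by (rule that)
qed

lemma integral_difference_eq_0:
  fixes f :: "'a::euclidean_space \<Rightarrow> real"
  assumes "integrable lborel f"
  shows "(\<integral>x. f (c + x) - f x \<partial>lborel) = 0"
proof -
  have [measurable]: "f \<in> borel_measurable borel"
    using assms by simp
  have "integrable (distr lborel borel ((+) c)) f"
    "(\<integral>x. f x \<partial>distr lborel borel ((+) c)) = (\<integral>x. f x \<partial>lborel)"
    using assms by (simp_all only: lborel_distr_plus)
  then show ?thesis
    using assms by (simp add: integrable_distr_eq integral_distr)
qed

lemma abs_difference_quotient_le:
  fixes f :: "'a::real_normed_vector \<Rightarrow> real"
  assumes f: "\<And>x. (f has_derivative f' x) (at x)" and bound: "\<And>x. \<bar>f' x u\<bar> \<le> B"
    and supp: "\<And>x. r < norm x \<Longrightarrow> f x = 0" and h: "0 < h" "h \<le> 1"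
  shows "\<bar>(f (h *\<^sub>R u + x) - f x) / h\<bar> \<le> B * indicator (cball 0 (r + norm u)) x"
proof (cases "x \<in> cball 0 (r + norm u)")
  case True
  obtain t where "f (x + h *\<^sub>R u) - f x = h * f' (x + t *\<^sub>R u) u"
    using mean_value_along_line[OF f h(1)] by blast
  then have "(f (h *\<^sub>R u + x) - f x) / h = f' (x + t *\<^sub>R u) u"
    using h(1) by (simp add: add.commute)
  then show ?thesis
    using bound True by simp
next
  case False
  then have "r + norm u < norm x"
    by simp
  moreover have "norm x \<le> norm (h *\<^sub>R u + x) + norm (h *\<^sub>R u)"
    using norm_triangle_ineq4[of "h *\<^sub>R u + x" "h *\<^sub>R u"] by simp
  moreover have "norm (h *\<^sub>R u) \<le> norm u"
    using h by (simp add: mult_left_le_one_le)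
  ultimately have "r < norm (h *\<^sub>R u + x)" "r < norm x"
    using norm_ge_zero[of u] by linarith+
  then show ?thesis
    using False by (simp add: supp)
qed

lemma tendsto_difference_quotient:
  fixes f :: "'a::real_normed_vector \<Rightarrow> real"
  assumes "(f has_derivative f') (at x)" and "filterlim h (at 0) F"
  shows "((\<lambda>n. (f (h n *\<^sub>R u + x) - f x) / h n) \<longlongrightarrow> f' u) F"
proof -
  have "((\<lambda>t. (f (x + t *\<^sub>R u) - f x) / t) \<longlongrightarrow> f' u) (at 0)"
    using has_real_derivative_along_line[of f f' x 0 u] assms(1) by (simp add: DERIV_def)
  then show ?thesis
    unfolding add.commute[of _ x] using assms(2) by (rule filterlim_compose)
qed

text \<open>By translation invariance every difference quotient has integral zero; the derivative is
  their dominated limit.\<close>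

lemma has_bochner_integral_directional_derivative:
  fixes f :: "'a::euclidean_space \<Rightarrow> real"
  assumes supp: "compactly_supported f" and f: "\<And>x. (f has_derivative f' x) (at x)"
    and cont': "continuous_on UNIV (\<lambda>x. f' x u)"
  shows "has_bochner_integral lborel (\<lambda>x. f' x u) 0"
proof -
  define h where "h n = inverse (real (Suc n))" for n
  have h: "0 < h n" "h n \<le> 1" for n
    by (simp_all add: h_def field_simps)
  have "h \<longlonglongrightarrow> 0"
    unfolding h_def by (rule LIMSEQ_inverse_real_of_nat)
  then have h_lim: "filterlim h (at 0) sequentially"
    unfolding filterlim_at using h(1) by (auto simp: less_imp_neq[symmetric])
  define Q where "Q n x = (f (h n *\<^sub>R u + x) - f x) / h n" for n x
  have cont: "continuous_on UNIV f"
    using f by (rule has_derivative_continuous_on)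
  obtain r where r: "\<And>x. r < norm x \<Longrightarrow> f x = 0"
    using compactly_supportedE[OF supp] by metis
  obtain B where B: "\<And>x. \<bar>f' x u\<bar> \<le> B"
    using bounded_compactly_supported[OF compactly_supported_derivative[OF supp f] cont'] by blast
  have "(\<lambda>n. \<integral>x. Q n x \<partial>lborel) \<longlonglongrightarrow> (\<integral>x. f' x u \<partial>lborel)"
  proof (rule integral_dominated_convergence)
    have [measurable]: "f \<in> borel_measurable borel"
      using cont by (rule borel_measurable_continuous_onI)
    show "Q n \<in> borel_measurable lborel" for n
      unfolding Q_def by measurable
    show "(\<lambda>x. f' x u) \<in> borel_measurable lborel"
      using borel_measurable_continuous_onI[OF cont'] by simp
    show "integrable lborel (\<lambda>x. B * indicator (cball 0 (r + norm u)) x)"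
      using emeasure_compact_finite[OF compact_cball]
      by (intro integrable_mult_right integrable_real_indicator) simp_all
    show "AE x in lborel. norm (Q n x) \<le> B * indicator (cball 0 (r + norm u)) x" for n
      using abs_difference_quotient_le[OF f B r h] by (simp add: Q_def)
    show "AE x in lborel. (\<lambda>n. Q n x) \<longlonglongrightarrow> f' x u"
      unfolding Q_def by (intro AE_I2 tendsto_difference_quotient f h_lim)
  qed
  moreover have "(\<integral>x. Q n x \<partial>lborel) = 0" for n
    by (simp add: Q_def integral_difference_eq_0 integrable_compactly_supported[OF supp cont])
  moreover have "integrable lborel (\<lambda>x. f' x u)"
    by (rule integrable_compactly_supported[OF compactly_supported_derivative[OF supp f] cont'])
  ultimately show ?thesis
    by (simp add: has_bochner_integral_iff LIMSEQ_const_iff)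
qed

definition linear_trace :: "('a::euclidean_space \<Rightarrow> 'a) \<Rightarrow> real" where
  "linear_trace A = (\<Sum>b\<in>Basis. A b \<bullet> b)"

lemma linear_trace_add: "linear_trace (\<lambda>u. A u + B u) = linear_trace A + linear_trace B"
  by (simp add: linear_trace_def inner_add_left sum.distrib)

lemma linear_trace_scaleR: "linear_trace (\<lambda>u. c *\<^sub>R A u) = c * linear_trace A"
  by (simp add: linear_trace_def sum_distrib_left)

lemma linear_trace_id: "linear_trace (\<lambda>u::'a::euclidean_space. u) = DIM('a)"
  by (simp add: linear_trace_def)

lemma linear_trace_rank_one:
  assumes "linear f" shows "linear_trace (\<lambda>u. f u *\<^sub>R z) = f z"
proof -
  have "f z = f (\<Sum>b\<in>Basis. (z \<bullet> b) *\<^sub>R b)"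
    by (simp add: euclidean_representation)
  also have "\<dots> = linear_trace (\<lambda>u. f u *\<^sub>R z)"
    using assms by (simp add: linear_sum linear_scale linear_trace_def mult.commute)
  finally show ?thesis by simp
qed

theorem has_bochner_integral_divergence:
  fixes Y :: "'a::euclidean_space \<Rightarrow> 'a"
  assumes supp: "compactly_supported Y" and Y: "\<And>x. (Y has_derivative Y' x) (at x)"
    and cont': "\<And>u. continuous_on UNIV (\<lambda>x. Y' x u)"
  shows "has_bochner_integral lborel (\<lambda>x. linear_trace (Y' x)) 0"
proof -
  have "has_bochner_integral lborel (\<lambda>x. Y' x b \<bullet> b) 0" for b
  proof (rule has_bochner_integral_directional_derivative[where f' = "\<lambda>x u. Y' x u \<bullet> b"])
    show "compactly_supported (\<lambda>x. Y x \<bullet> b)"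
      by (rule compactly_supported_subset[OF supp]) simp
  qed (auto intro!: derivative_eq_intros continuous_intros Y cont')
  then have "has_bochner_integral lborel (\<lambda>x. \<Sum>b\<in>Basis. Y' x b \<bullet> b) (\<Sum>b\<in>(Basis :: 'a set). 0)"
    by (intro has_bochner_integral_sum)
  then show ?thesis
    by (simp add: linear_trace_def)
qed

corollary has_bochner_integral_product_divergence:
  fixes s :: "'a::euclidean_space \<Rightarrow> real" and Z :: "'a \<Rightarrow> 'a"
  assumes supp: "compactly_supported (\<lambda>x. s x *\<^sub>R Z x)"
    and s: "\<And>x. (s has_derivative s' x) (at x)" "\<And>u. continuous_on UNIV (\<lambda>x. s' x u)"
    and Z: "\<And>x. (Z has_derivative Z' x) (at x)" "\<And>u. continuous_on UNIV (\<lambda>x. Z' x u)"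
  shows "has_bochner_integral lborel (\<lambda>x. s x * linear_trace (Z' x) + s' x (Z x)) 0"
proof -
  have [continuous_intros]: "continuous_on UNIV s" "continuous_on UNIV Z"
    by (rule has_derivative_continuous_on, rule s Z)+
  have "has_bochner_integral lborel (\<lambda>x. linear_trace (\<lambda>u. s x *\<^sub>R Z' x u + s' x u *\<^sub>R Z x)) 0"
    by (rule has_bochner_integral_divergence[OF supp])
       (intro has_derivative_scaleR s Z continuous_intros)+
  then show ?thesis
    using has_derivative_linear[OF s(1)]
    by (simp add: linear_trace_add linear_trace_scaleR linear_trace_rank_one)
qed

section \<open>Gradient and Hessian\<close>

lemma partial_deriv_eq_inner_grad:
  "b \<in> Basis \<Longrightarrow> partial_deriv b f x = b \<bullet> grad f x"
  by (simp add: grad_def inner_sum_right inner_Basis if_distrib cong: if_cong)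

lemma GDERIV_grad:
  assumes "f differentiable (at x)"
  shows "GDERIV f x :> grad f x"
proof -
  let ?D = "frechet_derivative f (at x)"
  have "?D u = u \<bullet> grad f x" for u
  proof -
    have "?D u = ?D (\<Sum>b\<in>Basis. (u \<bullet> b) *\<^sub>R b)"
      by (simp add: euclidean_representation)
    also have "\<dots> = u \<bullet> grad f x"
      using linear_frechet_derivative[OF assms]
      by (simp add: linear_sum linear_scale grad_def partial_deriv_def inner_sum_right mult.commute)
    finally show ?thesis .
  qed
  then have "?D = (\<lambda>u. u \<bullet> grad f x)" ..
  with assms show ?thesis
    by (simp add: gderiv_def frechet_derivative_works)
qed

lemma C_k_SucD:
  assumes "C_k (Suc k) f" shows "C_k k f"
  using assms
  by (induction k arbitrary: f) (auto intro: differentiable_imp_continuous_on)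

lemma C_k_imp_continuous_on: "C_k k f \<Longrightarrow> continuous_on UNIV f"
  by (induction k) (auto dest: C_k_SucD simp del: C_k.simps(2))

lemma GDERIV_C_k: "C_k (Suc k) f \<Longrightarrow> GDERIV f x :> grad f x"
  by (rule GDERIV_grad) (simp add: differentiable_on_def)

lemma continuous_on_grad: "C_k (Suc k) f \<Longrightarrow> continuous_on UNIV (grad f)"
  unfolding grad_def by (auto intro!: continuous_intros C_k_imp_continuous_on)

definition hessian :: "('a::euclidean_space \<Rightarrow> real) \<Rightarrow> 'a \<Rightarrow> 'a \<Rightarrow> 'a" where
  "hessian f x u = (\<Sum>b\<in>Basis. (u \<bullet> grad (partial_deriv b f) x) *\<^sub>R b)"

lemma has_derivative_grad:
  assumes "C_k 2 f"
  shows "(grad f has_derivative hessian f x) (at x)"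
proof -
  have "(partial_deriv b f has_derivative (\<lambda>u. u \<bullet> grad (partial_deriv b f) x)) (at x)"
    if "b \<in> Basis" for b
    using assms that GDERIV_C_k[of 0 "partial_deriv b f" x] by (simp add: numeral_2_eq_2 gderiv_def)
  then show ?thesis
    unfolding grad_def[of f, abs_def] hessian_def[abs_def]
    by (intro has_derivative_sum has_derivative_scaleR_left)
qed

lemma continuous_on_hessian:
  assumes "C_k 2 f"
  shows "continuous_on UNIV (\<lambda>x. hessian f x u)"
  unfolding hessian_def using assms
  by (intro continuous_intros continuous_on_grad[of 0]) (simp add: numeral_2_eq_2)

lemma linear_trace_hessian: "linear_trace (hessian f x) = laplacian f x"
  by (simp add: linear_trace_def hessian_def laplacian_def partial_deriv_eq_inner_grad)

lemma hessian_symmetric: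
  assumes "C_k 2 f"
  shows "hessian f x u \<bullet> w = hessian f x w \<bullet> u"
proof (rule second_derivative_symmetric[where f' = "\<lambda>x u. u \<bullet> grad f x"
      and f\<^sub>u = "\<lambda>x w. hessian f x w \<bullet> u" and f\<^sub>w = "\<lambda>x u. hessian f x u \<bullet> w", symmetric])
  show "(f has_derivative (\<lambda>u. u \<bullet> grad f x)) (at x)" for x
    using GDERIV_C_k[of 1 f x] assms by (simp add: gderiv_def numeral_2_eq_2)
  show "((\<lambda>x. u \<bullet> grad f x) has_derivative (\<lambda>w. hessian f x w \<bullet> u)) (at x)" for x u
    by (auto intro!: derivative_eq_intros has_derivative_grad[OF assms] simp: inner_commute)
  then show "((\<lambda>x. w \<bullet> grad f x) has_derivative (\<lambda>u. hessian f x u \<bullet> w)) (at x)" for x .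
  have "continuous_on UNIV (\<lambda>x. hessian f x u \<bullet> w)" for u w
    by (intro continuous_intros continuous_on_hessian assms)
  then show "isCont (\<lambda>x. hessian f x w \<bullet> u) x" "isCont (\<lambda>x. hessian f x u \<bullet> w) x"
    by (simp_all add: continuous_on_eq_continuous_at)
qed

lemma continuous_on_linear_apply:
  fixes A :: "'a::topological_space \<Rightarrow> 'b::euclidean_space \<Rightarrow> 'c::real_normed_vector"
  assumes "\<And>x. linear (A x)" and "\<And>u. continuous_on S (\<lambda>x. A x u)" and "continuous_on S z"
  shows "continuous_on S (\<lambda>x. A x (z x))"
proof -
  have "A x (z x) = A x (\<Sum>b\<in>Basis. (z x \<bullet> b) *\<^sub>R b)" for x
    by (simp add: euclidean_representation)
  then have "A x (z x) = (\<Sum>b\<in>Basis. (z x \<bullet> b) *\<^sub>R A x b)" for x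
    using assms(1)[of x] by (simp add: linear_sum linear_scale)
  then show ?thesis
    by (simp only:) (intro continuous_intros assms)
qed

section \<open>Cutoff functions\<close>

lemma DERIV_max_0_power:
  assumes "2 \<le> n"
  shows "((\<lambda>s::real. max 0 s ^ n) has_real_derivative n * max 0 s ^ (n - 1)) (at s)"
proof -
  consider "s < 0" | "s > 0" | "s = 0" by linarith
  then show ?thesis
  proof cases
    assume "s < 0"
    have "((\<lambda>s::real. 0) has_real_derivative 0) (at s)" by simp
    then have "((\<lambda>s::real. max 0 s ^ n) has_real_derivative 0) (at s)"
      by (rule has_field_derivative_transform_within_open[of _ _ _ "{..<0}"])
         (use \<open>s < 0\<close> \<open>2 \<le> n\<close> in auto)
    then show ?thesis
      using \<open>s < 0\<close> \<open>2 \<le> n\<close> by (simp add: power_0_left)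
  next
    assume "s > 0"
    have "((\<lambda>s. max 0 s ^ n) has_real_derivative n * s ^ (n - 1)) (at s)"
      by (rule has_field_derivative_transform_within_open[of "\<lambda>s. s ^ n" _ _ "{0<..}"])
         (use \<open>s > 0\<close> in \<open>auto intro!: derivative_eq_intros\<close>)
    then show ?thesis
      using \<open>s > 0\<close> by simp
  next
    assume "s = 0"
    have "((\<lambda>t::real. max 0 t ^ (n - 1)) \<longlongrightarrow> max 0 0 ^ (n - 1)) (at 0)"
      by (intro tendsto_intros)
    moreover have "max 0 t ^ (n - 1) = max 0 t ^ n / t" if "t \<noteq> 0" for t :: real
      using that \<open>2 \<le> n\<close> by (auto simp: max_def power_diff power_0_left)
    ultimately have "((\<lambda>t::real. max 0 t ^ n / t) \<longlongrightarrow> 0) (at 0)"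
      using \<open>2 \<le> n\<close> by (subst (asm) Lim_cong_within[OF refl refl refl]) (auto simp: power_0_left)
    then show ?thesis
      using \<open>s = 0\<close> \<open>2 \<le> n\<close> by (simp add: DERIV_def power_0_left)
  qed
qed

text \<open>\<open>step\<close> is built so that its derivative is a multiple of \<open>bump\<close>: the energy identity for the
  cutoff \<open>bump\<close> then controls the errors caused by the cutoff \<open>step\<close>.\<close>

definition bump :: "real \<Rightarrow> real" where
  "bump s = (max 0 (s - s ^ 4))\<^sup>2"

definition step :: "real \<Rightarrow> real" where
  "step s = max 0 (1 - max 0 s ^ 3) ^ 3"

lemma bump_nonneg: "0 \<le> bump s"
  by (simp add: bump_def)

lemma bump_factorization: "bump s = (max 0 s * max 0 (1 - max 0 s ^ 3))\<^sup>2"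
proof (cases "0 < s")
  case True
  have "s - s ^ 4 = s * (1 - s ^ 3)"
    by (simp add: algebra_simps power_numeral_reduce)
  with True show ?thesis
    by (simp add: bump_def max_mult_distrib_left)
next
  case False
  then have "s - s ^ 4 \<le> 0"
    by (simp add: order_trans[of s 0])
  with False show ?thesis
    by (simp add: bump_def)
qed

lemma bump_nonzeroD:
  assumes "bump s \<noteq> 0" shows "0 < s" "s < 1"
proof -
  show "0 < s"
    using assms by (auto simp: bump_factorization max_def split: if_splits)
  moreover have "\<not> 1 \<le> max 0 s ^ 3"
    using assms by (auto simp: bump_factorization)
  ultimately show "s < 1"
    by (cases "1 \<le> s") auto
qed

lemma bump_le_1: "bump s \<le> 1"
proof (cases "bump s = 0")
  case False
  then have "0 < s" "s < 1"
    by (rule bump_nonzeroD)+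
  moreover from this have "0 \<le> s ^ 4"
    by simp
  ultimately have "s - s ^ 4 \<le> 1"
    by linarith
  then show ?thesis
    unfolding bump_def by (intro power_le_one) simp_all
qed simp

lemma step_nonneg: "0 \<le> step s"
  by (simp add: step_def)

lemma step_le_1: "step s \<le> 1"
  by (simp add: step_def power_le_one)

lemma step_eq_1: "s \<le> 0 \<Longrightarrow> step s = 1"
  by (simp add: step_def)

lemma step_eq_0: "1 \<le> s \<Longrightarrow> step s = 0"
  by (simp add: step_def)

definition bump' :: "real \<Rightarrow> real" where
  "bump' s = 2 * max 0 (s - s ^ 4) * (1 - 4 * s ^ 3)"

lemma DERIV_bump: "(bump has_real_derivative bump' s) (at s)"
proof -
  have "((\<lambda>s. s - s ^ 4) has_real_derivative 1 - 4 * s ^ 3) (at s)"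
    by (auto intro!: derivative_eq_intros)
  from DERIV_chain2[OF DERIV_max_0_power[of 2] this] show ?thesis
    by (simp add: bump_def[abs_def] bump'_def)
qed

lemma bump'_square_le: "(bump' s)\<^sup>2 \<le> 36 * bump s"
proof (cases "bump s = 0")
  case True
  then show ?thesis
    by (simp add: bump_def bump'_def)
next
  case False
  then have "0 \<le> s ^ 3" "s ^ 3 \<le> 1"
    using bump_nonzeroD[of s] by (auto intro: power_le_one)
  then have "(1 - 4 * s ^ 3)\<^sup>2 \<le> 3\<^sup>2"
    by (intro power2_le_iff_abs_le[THEN iffD2]) linarith+
  then have "4 * bump s * (1 - 4 * s ^ 3)\<^sup>2 \<le> 4 * bump s * 3\<^sup>2"
    using bump_nonneg[of s] by (intro mult_left_mono) auto
  then show ?thesis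
    by (simp add: bump_def bump'_def power_mult_distrib)
qed

lemma DERIV_step: "(step has_real_derivative - 9 * bump s) (at s)"
proof -
  have "((\<lambda>s. 1 - max 0 s ^ 3) has_real_derivative 0 - 3 * (max 0 s)\<^sup>2) (at s)"
    using DERIV_max_0_power[of 3 s] by (intro DERIV_diff DERIV_const) simp
  from DERIV_chain2[OF DERIV_max_0_power[of 3] this]
  have "(step has_real_derivative 3 * (max 0 (1 - max 0 s ^ 3))\<^sup>2 * (0 - 3 * (max 0 s)\<^sup>2)) (at s)"
    by (simp add: step_def[abs_def])
  also have "3 * (max 0 (1 - max 0 s ^ 3))\<^sup>2 * (0 - 3 * (max 0 s)\<^sup>2) = - 9 * bump s"
    by (simp add: bump_factorization power_mult_distrib)
  finally show ?thesis .
qed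

definition ball_cutoff :: "real \<Rightarrow> 'a::euclidean_space \<Rightarrow> real" where
  "ball_cutoff R x = (max 0 (1 - (x \<bullet> x) / R\<^sup>2))\<^sup>2"

definition ball_cutoff_grad :: "real \<Rightarrow> 'a::euclidean_space \<Rightarrow> 'a" where
  "ball_cutoff_grad R x = (2 * max 0 (1 - (x \<bullet> x) / R\<^sup>2)) *\<^sub>R (- (2 / R\<^sup>2) *\<^sub>R x)"

lemma GDERIV_ball_cutoff: "GDERIV (ball_cutoff R) x :> ball_cutoff_grad R x"
proof -
  have "GDERIV (\<lambda>x. 1 - (x \<bullet> x) * c) x :> - (2 * c) *\<^sub>R x" for c
    by (auto simp: gderiv_def inner_commute intro!: derivative_eq_intros)
  from GDERIV_DERIV_compose[OF this DERIV_max_0_power[of 2]] show ?thesis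
    by (simp add: ball_cutoff_def[abs_def] ball_cutoff_grad_def divide_inverse)
qed

lemma continuous_on_ball_cutoff [continuous_intros]:
  "continuous_on S (ball_cutoff R)" "continuous_on S (ball_cutoff_grad R)"
  unfolding ball_cutoff_def ball_cutoff_grad_def divide_inverse by (intro continuous_intros)+

lemma ball_cutoff_nonneg: "0 \<le> ball_cutoff R x"
  by (simp add: ball_cutoff_def)

lemma ball_cutoff_le_1: "ball_cutoff R x \<le> 1"
  by (simp add: ball_cutoff_def power_le_one)

lemma ball_cutoff_mono:
  assumes "0 < R" "R \<le> R'"
  shows "ball_cutoff R x \<le> ball_cutoff R' x"
  unfolding ball_cutoff_def using assms
  by (intro power_mono max.mono diff_mono divide_left_mono) auto

lemma LIMSEQ_divide_Suc_square: "(\<lambda>n. c / (real (Suc n))\<^sup>2) \<longlonglongrightarrow> 0"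
  using tendsto_mult[OF tendsto_const tendsto_power[OF LIMSEQ_inverse_real_of_nat, of 2]]
  by (simp add: divide_inverse power_inverse)

lemma LIMSEQ_ball_cutoff: "(\<lambda>n. ball_cutoff (Suc n) x) \<longlonglongrightarrow> 1"
proof -
  have "(\<lambda>n. ball_cutoff (Suc n) x) \<longlonglongrightarrow> (max 0 (1 - 0))\<^sup>2"
    unfolding ball_cutoff_def by (intro tendsto_intros LIMSEQ_divide_Suc_square)
  then show ?thesis
    by simp
qed

lemma ball_cutoff_eq_0:
  assumes "0 < R" "R \<le> norm x" shows "ball_cutoff R x = 0"
  using assms by (simp add: ball_cutoff_def power_mono flip: power2_norm_eq_inner)

lemma compactly_supported_ball_cutoff: "0 < R \<Longrightarrow> compactly_supported (ball_cutoff R)"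
  by (rule compactly_supportedI[of "cball 0 R"]) (simp_all add: ball_cutoff_eq_0)

lemma norm_ball_cutoff_grad_square_le:
  assumes "0 < R"
  shows "(norm (ball_cutoff_grad R x))\<^sup>2 \<le> 16 / R\<^sup>2 * ball_cutoff R x"
proof (cases "ball_cutoff R x = 0")
  case True
  then show ?thesis
    by (simp add: ball_cutoff_def ball_cutoff_grad_def)
next
  case False
  then have "(x \<bullet> x) / R\<^sup>2 \<le> 1"
    by (simp add: ball_cutoff_def max_def split: if_splits)
  have "(norm (ball_cutoff_grad R x))\<^sup>2 = 16 / R\<^sup>2 * ball_cutoff R x * ((x \<bullet> x) / R\<^sup>2)"
    by (simp add: ball_cutoff_def ball_cutoff_grad_def power_mult_distrib power_divide
        power2_norm_eq_inner)
  also have "\<dots> \<le> 16 / R\<^sup>2 * ball_cutoff R x * 1"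
    by (intro mult_left_mono \<open>(x \<bullet> x) / R\<^sup>2 \<le> 1\<close>) (simp add: ball_cutoff_nonneg)
  finally show ?thesis
    by simp
qed

section \<open>Energy and virial identities\<close>

locale potential =
  fixes v :: "'a::euclidean_space \<Rightarrow> real"
  assumes v_C1: "C_k (Suc 0) v" and v_nonneg: "0 \<le> v x"
begin

lemmas GDERIV_v = GDERIV_C_k[OF v_C1]

lemmas continuous_on_v [continuous_intros] =
  C_k_imp_continuous_on[OF v_C1] continuous_on_grad[OF v_C1]

lemma potential_energy_nonneg: "0 \<le> potential_energy v \<psi>"
  unfolding potential_energy_def by (simp add: integral_nonneg v_nonneg)

end

locale eigenfunction = potential v for v :: "'a::euclidean_space \<Rightarrow> real" +
  fixes h E :: real and \<psi> :: "'a \<Rightarrow> real"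
  assumes eigen: "normalized_eigenfunction v h E \<psi>"
begin

definition energy_density :: "'a \<Rightarrow> real" where
  "energy_density x = h\<^sup>2 * (norm (grad \<psi> x))\<^sup>2 + (v x - E) * (\<psi> x)\<^sup>2"

definition weighted_energy :: "('a \<Rightarrow> real) \<Rightarrow> real" where
  "weighted_energy \<rho> = (\<integral>x. \<rho> x * energy_density x \<partial>lborel)"

definition weighted_kinetic :: "('a \<Rightarrow> real) \<Rightarrow> real" where
  "weighted_kinetic \<rho> = h\<^sup>2 * (\<integral>x. \<rho> x * (norm (grad \<psi> x))\<^sup>2 \<partial>lborel)"

lemma \<psi>_C2: "C_k 2 \<psi>"
  using eigen by (simp add: normalized_eigenfunction_def)

lemma \<psi>_C1: "C_k (Suc 0) \<psi>"
  by (rule C_k_SucD) (use \<psi>_C2 in \<open>simp only: numeral_2_eq_2\<close>)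

lemmas GDERIV_\<psi> = GDERIV_C_k[OF \<psi>_C1]

lemmas continuous_on_\<psi> [continuous_intros] =
  C_k_imp_continuous_on[OF \<psi>_C1] continuous_on_grad[OF \<psi>_C1] continuous_on_hessian[OF \<psi>_C2]

lemma continuous_on_energy_density [continuous_intros]: "continuous_on UNIV energy_density"
  unfolding energy_density_def by (intro continuous_intros)

lemma eigenvalue_equation: "h\<^sup>2 * linear_trace (hessian \<psi> x) = (v x - E) * \<psi> x"
proof -
  have "- h\<^sup>2 * laplacian \<psi> x + v x * \<psi> x = E * \<psi> x"
    using eigen by (simp only: normalized_eigenfunction_def)
  then show ?thesis
    by (simp add: linear_trace_hessian algebra_simps)
qed

lemma integrable_square: "integrable lborel (\<lambda>x. (\<psi> x)\<^sup>2)"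
  and integral_square: "(\<integral>x. (\<psi> x)\<^sup>2 \<partial>lborel) = 1"
  using eigen by (simp_all add: normalized_eigenfunction_def)

lemma weighted_energy_eq:
  assumes "compactly_supported \<rho>" and "continuous_on UNIV \<rho>"
  shows "weighted_energy \<rho> = weighted_kinetic \<rho> + (\<integral>x. \<rho> x * ((v x - E) * (\<psi> x)\<^sup>2) \<partial>lborel)"
proof -
  have "\<rho> x * energy_density x = h\<^sup>2 * (\<rho> x * (norm (grad \<psi> x))\<^sup>2) + \<rho> x * ((v x - E) * (\<psi> x)\<^sup>2)"
    for x
    by (simp add: energy_density_def algebra_simps)
  moreover have "integrable lborel (\<lambda>x. \<rho> x * (norm (grad \<psi> x))\<^sup>2)"
    "integrable lborel (\<lambda>x. \<rho> x * ((v x - E) * (\<psi> x)\<^sup>2))"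
    by (intro integrable_compactly_supported_mult assms continuous_intros)+
  ultimately show ?thesis
    by (simp add: weighted_energy_def weighted_kinetic_def)
qed

lemma integrable_cross_term:
  assumes supp: "compactly_supported \<rho>" and \<rho>: "\<And>x. GDERIV \<rho> x :> \<rho>' x"
    and \<rho>'_cont: "continuous_on UNIV \<rho>'"
  shows "integrable lborel (\<lambda>x. \<psi> x * (grad \<psi> x \<bullet> \<rho>' x))"
proof (rule integrable_compactly_supported)
  have "compactly_supported (\<lambda>x. grad \<psi> x \<bullet> \<rho>' x)"
    using \<rho> unfolding gderiv_def by (rule compactly_supported_derivative[OF supp])
  then show "compactly_supported (\<lambda>x. \<psi> x * (grad \<psi> x \<bullet> \<rho>' x))"
    by (rule compactly_supported_subset) simp
qed (intro continuous_intros \<rho>'_cont)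

lemma energy_identity:
  assumes supp: "compactly_supported \<rho>" and \<rho>: "\<And>x. GDERIV \<rho> x :> \<rho>' x"
    and \<rho>'_cont: "continuous_on UNIV \<rho>'"
  shows "weighted_energy \<rho> = - h\<^sup>2 * (\<integral>x. \<psi> x * (grad \<psi> x \<bullet> \<rho>' x) \<partial>lborel)"
proof -
  define gradient_div where "gradient_div x = (\<rho> x * \<psi> x) * linear_trace (hessian \<psi> x)
    + grad \<psi> x \<bullet> (\<rho> x *\<^sub>R grad \<psi> x + \<psi> x *\<^sub>R \<rho>' x)" for x
  define cross where "cross x = \<psi> x * (grad \<psi> x \<bullet> \<rho>' x)" for x
  have \<rho>_cont: "continuous_on UNIV \<rho>"
    using \<rho> unfolding gderiv_def by (rule has_derivative_continuous_on)
  have "has_bochner_integral lborel gradient_div 0"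
    unfolding gradient_div_def
  proof (rule has_bochner_integral_product_divergence
      [where s' = "\<lambda>x u. u \<bullet> (\<rho> x *\<^sub>R grad \<psi> x + \<psi> x *\<^sub>R \<rho>' x)" and Z = "grad \<psi>"])
    show "((\<lambda>x. \<rho> x * \<psi> x) has_derivative (\<lambda>u. u \<bullet> (\<rho> x *\<^sub>R grad \<psi> x + \<psi> x *\<^sub>R \<rho>' x))) (at x)" for x
      using GDERIV_mult[OF \<rho> GDERIV_\<psi>] by (simp add: gderiv_def)
    show "continuous_on UNIV (\<lambda>x. u \<bullet> (\<rho> x *\<^sub>R grad \<psi> x + \<psi> x *\<^sub>R \<rho>' x))" for u
      by (intro continuous_intros \<rho>_cont \<rho>'_cont)
    show "compactly_supported (\<lambda>x. (\<rho> x * \<psi> x) *\<^sub>R grad \<psi> x)"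
      by (rule compactly_supported_subset[OF supp]) simp
  qed (intro has_derivative_grad[OF \<psi>_C2] continuous_intros)+
  moreover have "integrable lborel cross"
    unfolding cross_def by (rule integrable_cross_term[OF supp \<rho> \<rho>'_cont])
  ultimately have "has_bochner_integral lborel (\<lambda>x. h\<^sup>2 * gradient_div x - h\<^sup>2 * cross x)
      (h\<^sup>2 * 0 - h\<^sup>2 * (\<integral>x. cross x \<partial>lborel))"
    by (intro has_bochner_integral_diff has_bochner_integral_mult_right
        has_bochner_integral_integrable)
  moreover have "h\<^sup>2 * gradient_div x - h\<^sup>2 * cross x = \<rho> x * energy_density x" for x
  proof -
    have "h\<^sup>2 * (\<rho> x * \<psi> x * linear_trace (hessian \<psi> x))
        = \<rho> x * \<psi> x * (h\<^sup>2 * linear_trace (hessian \<psi> x))"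
      by simp
    also have "\<dots> = \<rho> x * ((v x - E) * (\<psi> x)\<^sup>2)"
      by (simp only: eigenvalue_equation) (simp add: power2_eq_square)
    finally show ?thesis
      by (simp add: gradient_div_def cross_def energy_density_def power2_norm_eq_inner
          inner_add_right algebra_simps)
  qed
  ultimately show ?thesis
    by (simp add: has_bochner_integral_iff cross_def weighted_energy_def)
qed

lemma has_derivative_energy_density:
  "(energy_density has_derivative (\<lambda>u. 2 * h\<^sup>2 * (grad \<psi> x \<bullet> hessian \<psi> x u)
      + ((u \<bullet> grad v x) * (\<psi> x)\<^sup>2 + 2 * (v x - E) * \<psi> x * (u \<bullet> grad \<psi> x)))) (at x)"
proof -
  have "(v has_derivative (\<lambda>u. u \<bullet> grad v x)) (at x)" "(\<psi> has_derivative (\<lambda>u. u \<bullet> grad \<psi> x)) (at x)"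
    using GDERIV_v GDERIV_\<psi> by (simp_all add: gderiv_def)
  then show ?thesis
    unfolding energy_density_def[abs_def] power2_norm_eq_inner
    by (auto intro!: derivative_eq_intros has_derivative_grad[OF \<psi>_C2]
        simp: inner_commute algebra_simps power2_eq_square)
qed

lemma has_bochner_integral_virial:
  assumes supp: "compactly_supported X" and X: "\<And>x. (X has_derivative X' x) (at x)"
    and [continuous_intros]: "\<And>u. continuous_on UNIV (\<lambda>x. X' x u)"
  shows "has_bochner_integral lborel (\<lambda>x. 2 * h\<^sup>2 * (X' x (grad \<psi> x) \<bullet> grad \<psi> x)
      - linear_trace (X' x) * energy_density x - (X x \<bullet> grad v x) * (\<psi> x)\<^sup>2) 0"
proof -
  define gradient_div where "gradient_div x = (X x \<bullet> grad \<psi> x) * linear_trace (hessian \<psi> x)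
    + (X x \<bullet> hessian \<psi> x (grad \<psi> x) + X' x (grad \<psi> x) \<bullet> grad \<psi> x)" for x
  define energy_div where "energy_div x = energy_density x * linear_trace (X' x)
    + (2 * h\<^sup>2 * (grad \<psi> x \<bullet> hessian \<psi> x (X x))
      + ((X x \<bullet> grad v x) * (\<psi> x)\<^sup>2 + 2 * (v x - E) * \<psi> x * (X x \<bullet> grad \<psi> x)))" for x
  have [continuous_intros]: "continuous_on UNIV X"
    using X by (rule has_derivative_continuous_on)
  have "has_bochner_integral lborel gradient_div 0"
    unfolding gradient_div_def
    by (rule has_bochner_integral_product_divergence)
       (intro has_derivative_inner X has_derivative_grad[OF \<psi>_C2] continuous_intros
         compactly_supported_subset[OF supp]; simp)+
  moreover have "has_bochner_integral lborel energy_div 0"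
    unfolding energy_div_def
    by (rule has_bochner_integral_product_divergence)
       (intro X has_derivative_energy_density continuous_intros
         compactly_supported_subset[OF supp]; simp)+
  ultimately have "has_bochner_integral lborel
      (\<lambda>x. 2 * h\<^sup>2 * gradient_div x - energy_div x) (2 * h\<^sup>2 * 0 - 0)"
    by (intro has_bochner_integral_diff has_bochner_integral_mult_right)
  moreover have "2 * h\<^sup>2 * gradient_div x - energy_div x = 2 * h\<^sup>2 * (X' x (grad \<psi> x) \<bullet> grad \<psi> x)
      - linear_trace (X' x) * energy_density x - (X x \<bullet> grad v x) * (\<psi> x)\<^sup>2" for x
  proof -
    have "2 * h\<^sup>2 * ((X x \<bullet> grad \<psi> x) * linear_trace (hessian \<psi> x))
        = 2 * (X x \<bullet> grad \<psi> x) * (h\<^sup>2 * linear_trace (hessian \<psi> x))"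
      by simp
    also have "\<dots> = 2 * (v x - E) * \<psi> x * (X x \<bullet> grad \<psi> x)"
      by (simp only: eigenvalue_equation) simp
    finally have "2 * h\<^sup>2 * ((X x \<bullet> grad \<psi> x) * linear_trace (hessian \<psi> x))
        = 2 * (v x - E) * \<psi> x * (X x \<bullet> grad \<psi> x)" .
    moreover have "X x \<bullet> hessian \<psi> x (grad \<psi> x) = grad \<psi> x \<bullet> hessian \<psi> x (X x)"
      using hessian_symmetric[OF \<psi>_C2] by (simp add: inner_commute)
    ultimately show ?thesis
      by (simp add: gradient_div_def energy_div_def algebra_simps)
  qed
  ultimately show ?thesis
    by (simp only: mult_zero_right diff_zero)
qed

lemma integrable_virial_terms:
  assumes supp: "compactly_supported X" and X: "\<And>x. (X has_derivative X' x) (at x)"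
    and X'_cont: "\<And>u. continuous_on UNIV (\<lambda>x. X' x u)"
  shows "integrable lborel (\<lambda>x. X' x (grad \<psi> x) \<bullet> grad \<psi> x)" (is "integrable _ ?kinetic")
    and "integrable lborel (\<lambda>x. (X x \<bullet> grad v x) * (\<psi> x)\<^sup>2)" (is "integrable _ ?potential")
    and "integrable lborel (\<lambda>x. linear_trace (X' x) * energy_density x)"
      (is "integrable _ ?divergence")
proof -
  have X_cont: "continuous_on UNIV X"
    using X by (rule has_derivative_continuous_on)
  show kinetic: "integrable lborel ?kinetic"
  proof (rule integrable_compactly_supported)
    show "compactly_supported ?kinetic"
      by (rule compactly_supported_subset[OF compactly_supported_derivative[OF supp X, of "grad \<psi>"]])
         simp
    show "continuous_on UNIV ?kinetic"
      by (intro continuous_intros continuous_on_linear_apply[of X' UNIV "grad \<psi>"]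
          has_derivative_linear[OF X] X'_cont)
  qed
  show potential: "integrable lborel ?potential"
    by (intro integrable_compactly_supported compactly_supported_subset[OF supp]
        continuous_intros X_cont) simp
  have "integrable lborel (\<lambda>x. 2 * h\<^sup>2 * ?kinetic x - ?potential x
      - (2 * h\<^sup>2 * ?kinetic x - ?divergence x - ?potential x))"
    by (intro Bochner_Integration.integrable_diff integrable_mult_right kinetic potential
        integrable.intros[OF has_bochner_integral_virial[OF supp X X'_cont]])
  then show "integrable lborel ?divergence"
    by simp
qed

theorem virial_identity:
  assumes "compactly_supported X" and "\<And>x. (X has_derivative X' x) (at x)"
    and "\<And>u. continuous_on UNIV (\<lambda>x. X' x u)"
  shows "2 * h\<^sup>2 * (\<integral>x. X' x (grad \<psi> x) \<bullet> grad \<psi> x \<partial>lborel)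
      - (\<integral>x. linear_trace (X' x) * energy_density x \<partial>lborel)
    = (\<integral>x. (X x \<bullet> grad v x) * (\<psi> x)\<^sup>2 \<partial>lborel)"
  using has_bochner_integral_integral_eq[OF has_bochner_integral_virial[OF assms]]
    integrable_virial_terms[OF assms] by simp

section \<open>Caccioppoli estimate and finiteness of the potential energy\<close>

text \<open>The hypothesis bounds the squared gradient of \<open>\<rho>\<close> by \<open>\<eta>\<close> itself, so that the cross term of the
  energy identity can be split by Young's inequality.\<close>

lemma abs_weighted_energy_le:
  assumes supp: "compactly_supported \<rho>" and \<rho>: "\<And>x. GDERIV \<rho> x :> \<rho>' x"
    and \<rho>'_cont: "continuous_on UNIV \<rho>'"
    and \<eta>: "compactly_supported \<eta>" "continuous_on UNIV \<eta>" "\<And>x. 0 \<le> \<eta> x"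
    and w: "integrable lborel w" "\<And>x. 0 \<le> w x"
    and \<rho>'_le: "\<And>x. (\<psi> x)\<^sup>2 * (norm (\<rho>' x))\<^sup>2 \<le> \<eta> x * w x"
  shows "\<bar>weighted_energy \<rho>\<bar> \<le> (weighted_kinetic \<eta> + h\<^sup>2 * (\<integral>x. w x \<partial>lborel)) / 2"
proof -
  define K where "K x = \<eta> x * (norm (grad \<psi> x))\<^sup>2" for x
  have K_nonneg: "0 \<le> K x" for x
    by (simp add: K_def \<eta>(3))
  have cross: "\<bar>\<psi> x * (grad \<psi> x \<bullet> \<rho>' x)\<bar> \<le> (K x + w x) / 2" for x
  proof (rule power2_le_imp_le)
    have "\<bar>\<psi> x * (grad \<psi> x \<bullet> \<rho>' x)\<bar>\<^sup>2 \<le> (\<psi> x)\<^sup>2 * ((norm (grad \<psi> x))\<^sup>2 * (norm (\<rho>' x))\<^sup>2)"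
      unfolding power2_abs power_mult_distrib using Cauchy_Schwarz_ineq[of "grad \<psi> x" "\<rho>' x"]
      by (intro mult_left_mono) (simp_all add: power2_norm_eq_inner)
    also have "\<dots> \<le> (norm (grad \<psi> x))\<^sup>2 * (\<eta> x * w x)"
      using mult_left_mono[OF \<rho>'_le, of "(norm (grad \<psi> x))\<^sup>2" x] by (simp add: mult_ac)
    also have "\<dots> = K x * w x"
      by (simp add: K_def)
    also have "\<dots> \<le> ((K x + w x) / 2)\<^sup>2"
      using zero_le_power2[of "K x - w x"] by (simp add: power2_eq_square field_simps)
    finally show "\<bar>\<psi> x * (grad \<psi> x \<bullet> \<rho>' x)\<bar>\<^sup>2 \<le> ((K x + w x) / 2)\<^sup>2" .
  qed (simp add: K_nonneg w(2))
  have int: "integrable lborel K"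
    unfolding K_def by (intro integrable_compactly_supported_mult \<eta> continuous_intros)
  have "\<bar>weighted_energy \<rho>\<bar> = h\<^sup>2 * \<bar>\<integral>x. \<psi> x * (grad \<psi> x \<bullet> \<rho>' x) \<partial>lborel\<bar>"
    by (simp add: energy_identity[OF supp \<rho> \<rho>'_cont] abs_mult)
  also have "\<dots> \<le> h\<^sup>2 * (\<integral>x. \<bar>\<psi> x * (grad \<psi> x \<bullet> \<rho>' x)\<bar> \<partial>lborel)"
    by (intro mult_left_mono integral_abs_bound) simp
  also have "\<dots> \<le> h\<^sup>2 * (\<integral>x. (K x + w x) / 2 \<partial>lborel)"
    by (intro mult_left_mono integral_mono' cross) (simp_all add: int w K_nonneg)
  also have "\<dots> = (weighted_kinetic \<eta> + h\<^sup>2 * (\<integral>x. w x \<partial>lborel)) / 2"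
    using int w(1) by (simp add: weighted_kinetic_def K_def[symmetric] algebra_simps)
  finally show ?thesis .
qed

corollary caccioppoli:
  assumes supp: "compactly_supported \<eta>" and \<eta>: "\<And>x. GDERIV \<eta> x :> \<eta>' x"
    and \<eta>'_cont: "continuous_on UNIV \<eta>'" and nonneg: "\<And>x. 0 \<le> \<eta> x"
    and w: "integrable lborel w" "\<And>x. 0 \<le> w x"
    and \<eta>'_le: "\<And>x. (\<psi> x)\<^sup>2 * (norm (\<eta>' x))\<^sup>2 \<le> \<eta> x * w x"
  shows "weighted_kinetic \<eta> / 2 + (\<integral>x. \<eta> x * ((v x - E) * (\<psi> x)\<^sup>2) \<partial>lborel)
    \<le> h\<^sup>2 / 2 * (\<integral>x. w x \<partial>lborel)"
proof -
  have cont: "continuous_on UNIV \<eta>"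
    using \<eta> unfolding gderiv_def by (rule has_derivative_continuous_on)
  show ?thesis
    using abs_le_D1[OF abs_weighted_energy_le[OF supp \<eta> \<eta>'_cont supp cont nonneg w \<eta>'_le]]
    by (simp add: weighted_energy_eq[OF supp cont])
qed

lemma truncated_potential_energy_le:
  assumes "0 < R"
  shows "(\<integral>x. ball_cutoff R x * (v x * (\<psi> x)\<^sup>2) \<partial>lborel)
    \<le> E * (\<integral>x. ball_cutoff R x * (\<psi> x)\<^sup>2 \<partial>lborel) + 8 * h\<^sup>2 / R\<^sup>2"
proof -
  have supp: "compactly_supported (ball_cutoff R :: 'a \<Rightarrow> real)"
    using assms by (rule compactly_supported_ball_cutoff)
  have "(\<psi> x)\<^sup>2 * (norm (ball_cutoff_grad R x))\<^sup>2 \<le> ball_cutoff R x * (16 / R\<^sup>2 * (\<psi> x)\<^sup>2)" for x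
    using mult_left_mono[OF norm_ball_cutoff_grad_square_le[OF assms], of "(\<psi> x)\<^sup>2" x]
    by (simp add: mult_ac)
  then have "weighted_kinetic (ball_cutoff R) / 2
      + (\<integral>x. ball_cutoff R x * ((v x - E) * (\<psi> x)\<^sup>2) \<partial>lborel)
      \<le> h\<^sup>2 / 2 * (\<integral>x. 16 / R\<^sup>2 * (\<psi> x)\<^sup>2 \<partial>lborel)"
    by (intro caccioppoli[OF supp GDERIV_ball_cutoff] continuous_intros ball_cutoff_nonneg
        integrable_mult_right integrable_square) simp_all
  moreover have "0 \<le> weighted_kinetic (ball_cutoff R)"
    by (simp add: weighted_kinetic_def integral_nonneg ball_cutoff_nonneg)
  moreover have "(\<integral>x. ball_cutoff R x * ((v x - E) * (\<psi> x)\<^sup>2) \<partial>lborel)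
      = (\<integral>x. ball_cutoff R x * (v x * (\<psi> x)\<^sup>2) \<partial>lborel)
        - E * (\<integral>x. ball_cutoff R x * (\<psi> x)\<^sup>2 \<partial>lborel)"
  proof -
    have "integrable lborel (\<lambda>x. ball_cutoff R x * (v x * (\<psi> x)\<^sup>2))"
      "integrable lborel (\<lambda>x. ball_cutoff R x * (\<psi> x)\<^sup>2)"
      by (intro integrable_compactly_supported_mult supp continuous_intros)+
    moreover have "ball_cutoff R x * ((v x - E) * (\<psi> x)\<^sup>2)
        = ball_cutoff R x * (v x * (\<psi> x)\<^sup>2) - E * (ball_cutoff R x * (\<psi> x)\<^sup>2)" for x
      by (simp add: algebra_simps)
    ultimately show ?thesis
      by simp
  qed
  ultimately show ?thesis
    by (simp add: integral_square)
qed

lemma tendsto_truncated_mass: "(\<lambda>n. \<integral>x. ball_cutoff (Suc n) x * (\<psi> x)\<^sup>2 \<partial>lborel) \<longlonglongrightarrow> 1"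
  unfolding integral_square[symmetric]
proof (rule integral_dominated_convergence[OF _ _ integrable_square])
  have [measurable]: "\<psi> \<in> borel_measurable borel" "ball_cutoff R \<in> borel_measurable borel" for R
    by (intro borel_measurable_continuous_onI continuous_intros)+
  show "(\<lambda>x. (\<psi> x)\<^sup>2) \<in> borel_measurable lborel"
    "(\<lambda>x. ball_cutoff (Suc n) x * (\<psi> x)\<^sup>2) \<in> borel_measurable lborel" for n
    by measurable
  show "AE x in lborel. (\<lambda>n. ball_cutoff (Suc n) x * (\<psi> x)\<^sup>2) \<longlonglongrightarrow> (\<psi> x)\<^sup>2"
    by (intro AE_I2 tendsto_eq_rhs[OF tendsto_mult[OF LIMSEQ_ball_cutoff tendsto_const]]) simp
  show "AE x in lborel. norm (ball_cutoff (Suc n) x * (\<psi> x)\<^sup>2) \<le> (\<psi> x)\<^sup>2" for n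
    by (simp add: abs_mult ball_cutoff_nonneg ball_cutoff_le_1 mult_left_le_one_le)
qed

theorem integrable_potential: "integrable lborel (\<lambda>x. v x * (\<psi> x)\<^sup>2)"
  and potential_energy_le_eigenvalue: "potential_energy v \<psi> \<le> E"
proof -
  define U where "U n = (\<integral>x. ball_cutoff (Suc n) x * (v x * (\<psi> x)\<^sup>2) \<partial>lborel)" for n
  define bound where "bound n = E * (\<integral>x. ball_cutoff (Suc n) x * (\<psi> x)\<^sup>2 \<partial>lborel)
    + 8 * h\<^sup>2 / (real (Suc n))\<^sup>2" for n
  have int: "integrable lborel (\<lambda>x. ball_cutoff (Suc n) x * (v x * (\<psi> x)\<^sup>2))" for n
    by (intro integrable_compactly_supported_mult compactly_supported_ball_cutoff
        continuous_intros) simp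
  have mono: "mono (\<lambda>n. ball_cutoff (Suc n) x * (v x * (\<psi> x)\<^sup>2))" for x
    by (intro monoI mult_right_mono ball_cutoff_mono) (simp_all add: v_nonneg)
  have bound_lim: "bound \<longlonglongrightarrow> E * 1 + 0"
    unfolding bound_def by (intro tendsto_add tendsto_mult tendsto_const tendsto_truncated_mass
        LIMSEQ_divide_Suc_square)
  have U_le: "U n \<le> bound n" for n
    unfolding U_def bound_def by (rule truncated_potential_energy_le) simp
  have "incseq U"
    unfolding U_def by (intro monoI Bochner_Integration.integral_mono int monoD[OF mono])
  moreover obtain B where B: "\<And>n. \<bar>bound n\<bar> \<le> B"
    using convergent_imp_Bseq[OF convergentI[OF bound_lim]]
    unfolding Bseq_def real_norm_def by blast
  have "\<forall>n. U n \<le> B"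
    by (intro allI order_trans[OF U_le abs_le_D1[OF B]])
  ultimately obtain L where L: "U \<longlonglongrightarrow> L"
    by (rule incseq_convergent)
  have "L \<le> E"
    using LIMSEQ_le[OF L bound_lim] U_le by simp
  moreover have "has_bochner_integral lborel (\<lambda>x. v x * (\<psi> x)\<^sup>2) L"
  proof (rule has_bochner_integral_monotone_convergence[OF int])
    show "AE x in lborel. (\<lambda>n. ball_cutoff (Suc n) x * (v x * (\<psi> x)\<^sup>2)) \<longlonglongrightarrow> v x * (\<psi> x)\<^sup>2"
      by (intro AE_I2 tendsto_eq_rhs[OF tendsto_mult[OF LIMSEQ_ball_cutoff tendsto_const]]) simp
    show "(\<lambda>x. v x * (\<psi> x)\<^sup>2) \<in> borel_measurable lborel"
      unfolding measurable_lborel2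
      by (intro borel_measurable_continuous_onI continuous_intros)
  qed (use mono L in \<open>simp_all add: U_def[abs_def]\<close>)
  ultimately show "integrable lborel (\<lambda>x. v x * (\<psi> x)\<^sup>2)" "potential_energy v \<psi> \<le> E"
    by (simp_all add: potential_energy_def has_bochner_integral_iff)
qed

end

section \<open>The virial estimate\<close>

locale virial_field = potential v for v :: "'a::euclidean_space \<Rightarrow> real" +
  fixes \<xi> :: "'a \<Rightarrow> 'a" and a b c D R :: real
  assumes a_pos: "0 < a" and a_less_b: "a < b" and c_nonneg: "0 \<le> c"
    and compact_sublevel: "compact {x. v x \<le> b}"
    and has_derivative_\<xi>: "v x \<le> b \<Longrightarrow> (\<xi> has_derivative (\<lambda>u. u)) (at x)"
    and virial_le: "v x \<le> b \<Longrightarrow> \<xi> x \<bullet> grad v x \<le> c * v x"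
    and D_nonneg: "0 \<le> D" and norm_grad_le: "v x \<le> b \<Longrightarrow> norm (grad v x) \<le> D"
    and R_nonneg: "0 \<le> R" and norm_\<xi>_le: "v x \<le> b \<Longrightarrow> norm (\<xi> x) \<le> R"
begin

definition cutoff :: "'a \<Rightarrow> real" where
  "cutoff x = step ((v x - a) / (b - a))"

definition shell :: "'a \<Rightarrow> real" where
  "shell x = bump ((v x - a) / (b - a))"

definition slope :: real where
  "slope = 9 / (b - a)"

definition gradient_bound :: real where
  "gradient_bound = slope * D"

definition cutoff_grad :: "'a \<Rightarrow> 'a" where
  "cutoff_grad x = - (slope * shell x) *\<^sub>R grad v x"

definition shell_grad :: "'a \<Rightarrow> 'a" where
  "shell_grad x = (bump' ((v x - a) / (b - a)) / (b - a)) *\<^sub>R grad v x"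

definition multiplier :: "'a \<Rightarrow> 'a" where
  "multiplier x = cutoff x *\<^sub>R \<xi> x"

definition multiplier_deriv :: "'a \<Rightarrow> 'a \<Rightarrow> 'a" where
  "multiplier_deriv x u = cutoff x *\<^sub>R u + (u \<bullet> cutoff_grad x) *\<^sub>R \<xi> x"

lemma slope_pos: "0 < slope"
  using a_less_b by (simp add: slope_def)

lemma gradient_bound_nonneg: "0 \<le> gradient_bound"
  using slope_pos D_nonneg by (simp add: gradient_bound_def)

lemma cutoff_nonneg: "0 \<le> cutoff x" and cutoff_le_1: "cutoff x \<le> 1"
  by (simp_all add: cutoff_def step_nonneg step_le_1)

lemma cutoff_eq_1: "v x \<le> a \<Longrightarrow> cutoff x = 1"
  using a_less_b by (auto simp: cutoff_def divide_nonpos_pos intro: step_eq_1)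

lemma cutoff_eq_0: "b \<le> v x \<Longrightarrow> cutoff x = 0"
  using a_less_b by (auto simp: cutoff_def intro!: step_eq_0)

lemma shell_nonneg: "0 \<le> shell x" and shell_le_1: "shell x \<le> 1"
  by (simp_all add: shell_def bump_nonneg bump_le_1)

lemma shell_nonzeroD:
  assumes "shell x \<noteq> 0" shows "a < v x" "v x < b"
  using bump_nonzeroD[of "(v x - a) / (b - a)"] assms a_less_b
  by (auto simp: shell_def zero_less_divide_iff)

lemma GDERIV_scaled_potential: "GDERIV (\<lambda>x. (v x - a) / (b - a)) x :> (1 / (b - a)) *\<^sub>R grad v x"
  using GDERIV_v[of x] a_less_b by (auto simp: gderiv_def intro!: derivative_eq_intros)

lemma GDERIV_cutoff: "GDERIV cutoff x :> cutoff_grad x"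
  using GDERIV_DERIV_compose[OF GDERIV_scaled_potential DERIV_step]
  by (simp add: cutoff_def[abs_def] cutoff_grad_def slope_def shell_def mult.commute)

lemma GDERIV_shell: "GDERIV shell x :> shell_grad x"
  using GDERIV_DERIV_compose[OF GDERIV_scaled_potential DERIV_bump]
  by (simp add: shell_def[abs_def] shell_grad_def)

lemma continuous_on_cutoff [continuous_intros]:
  "continuous_on UNIV cutoff" "continuous_on UNIV shell"
  "continuous_on UNIV cutoff_grad" "continuous_on UNIV shell_grad"
  unfolding cutoff_def shell_def cutoff_grad_def shell_grad_def step_def bump_def bump'_def
    divide_inverse
  by (intro continuous_intros)+

lemma compactly_supported_cutoff: "compactly_supported cutoff"
  and compactly_supported_shell: "compactly_supported shell"
  using shell_nonzeroD by (force intro!: compactly_supportedI[OF compact_sublevel] cutoff_eq_0)+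

lemma norm_cutoff_grad_le: "norm (cutoff_grad x) \<le> gradient_bound * shell x"
proof (cases "shell x = 0")
  case False
  then have "norm (grad v x) \<le> D"
    by (intro norm_grad_le less_imp_le shell_nonzeroD)
  then have "slope * shell x * norm (grad v x) \<le> slope * shell x * D"
    using slope_pos shell_nonneg[of x] by (intro mult_left_mono) auto
  then show ?thesis
    using slope_pos shell_nonneg[of x]
    by (simp add: cutoff_grad_def gradient_bound_def abs_mult mult_ac)
qed (simp add: cutoff_grad_def)

lemma norm_cutoff_grad_square_le: "(norm (cutoff_grad x))\<^sup>2 \<le> gradient_bound\<^sup>2 * shell x"
proof -
  have "(norm (cutoff_grad x))\<^sup>2 \<le> (gradient_bound * shell x)\<^sup>2"
    by (intro power_mono norm_cutoff_grad_le) simp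
  also have "\<dots> = gradient_bound\<^sup>2 * (shell x * shell x)"
    by (simp add: power2_eq_square)
  also have "\<dots> \<le> gradient_bound\<^sup>2 * shell x"
    using shell_nonneg[of x] shell_le_1[of x] by (intro mult_left_mono mult_left_le) auto
  finally show ?thesis .
qed

lemma norm_shell_grad_square_le: "(norm (shell_grad x))\<^sup>2 \<le> gradient_bound\<^sup>2 * shell x"
proof (cases "shell x = 0")
  case True
  then show ?thesis
    using bump'_square_le[of "(v x - a) / (b - a)"] by (simp add: shell_def shell_grad_def)
next
  case False
  have "(norm (shell_grad x))\<^sup>2 = (bump' ((v x - a) / (b - a)))\<^sup>2 * (norm (grad v x))\<^sup>2 / (b - a)\<^sup>2"
    by (simp add: shell_grad_def power_mult_distrib power_divide)
  also have "\<dots> \<le> 81 * shell x * D\<^sup>2 / (b - a)\<^sup>2"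
  proof (intro divide_right_mono mult_mono power_mono norm_grad_le)
    show "(bump' ((v x - a) / (b - a)))\<^sup>2 \<le> 81 * shell x"
      using bump'_square_le[of "(v x - a) / (b - a)"] shell_nonneg[of x] by (simp add: shell_def)
    show "v x \<le> b"
      using shell_nonzeroD[OF False] by simp
  qed (simp_all add: shell_nonneg)
  also have "\<dots> = gradient_bound\<^sup>2 * shell x"
    by (simp add: gradient_bound_def slope_def power_mult_distrib power_divide)
  finally show ?thesis .
qed

lemma has_derivative_multiplier: "(multiplier has_derivative multiplier_deriv x) (at x)"
proof (cases "v x \<le> b")
  case True
  then show ?thesis
    using has_derivative_scaleR[OF GDERIV_cutoff[unfolded gderiv_def] has_derivative_\<xi>]
    by (simp add: multiplier_def[abs_def] multiplier_deriv_def[abs_def])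
next
  case False
  have "open {x. b < v x}"
    by (intro open_Collect_less continuous_intros)
  then have "(multiplier has_derivative (\<lambda>_. 0)) (at x)"
    by (rule has_derivative_transform_within_open[OF has_derivative_const])
       (use False in \<open>auto simp: multiplier_def cutoff_eq_0\<close>)
  moreover have "multiplier_deriv x = (\<lambda>_. 0)"
    using False shell_nonzeroD(2)[of x]
    by (force simp: multiplier_deriv_def cutoff_grad_def cutoff_eq_0)
  ultimately show ?thesis
    by simp
qed

lemma continuous_on_scaleR_\<xi>:
  assumes "continuous_on UNIV k" and "\<And>x. b \<le> v x \<Longrightarrow> k x = 0"
  shows "continuous_on UNIV (\<lambda>x. k x *\<^sub>R \<xi> x)"
proof -
  have "continuous_on {x. v x \<le> b} \<xi>"
    by (rule has_derivative_continuous_on[OF has_derivative_at_withinI[OF has_derivative_\<xi>]]) simp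
  then have "continuous_on {x. v x \<le> b} (\<lambda>x. k x *\<^sub>R \<xi> x)"
    by (intro continuous_intros continuous_on_subset[OF assms(1)]) auto
  moreover have "continuous_on {x. b \<le> v x} (\<lambda>x. k x *\<^sub>R \<xi> x)"
    by (subst continuous_on_cong[OF refl, of _ _ "\<lambda>_. 0"]) (simp_all add: assms(2))
  moreover have "closed {x. v x \<le> b}" "closed {x. b \<le> v x}"
    by (intro closed_Collect_le continuous_intros)+
  ultimately have "continuous_on ({x. v x \<le> b} \<union> {x. b \<le> v x}) (\<lambda>x. k x *\<^sub>R \<xi> x)"
    by (intro continuous_on_closed_Un)
  also have "{x. v x \<le> b} \<union> {x. b \<le> v x} = UNIV"
    by auto
  finally show ?thesis .
qed

lemma continuous_on_multiplier_deriv: "continuous_on UNIV (\<lambda>x. multiplier_deriv x u)"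
  unfolding multiplier_deriv_def
proof (intro continuous_on_add continuous_on_scaleR_\<xi>)
  show "u \<bullet> cutoff_grad x = 0" if "b \<le> v x" for x
    using that shell_nonzeroD(2)[of x] by (force simp: cutoff_grad_def)
qed (intro continuous_intros)+

lemma compactly_supported_multiplier: "compactly_supported multiplier"
  by (rule compactly_supported_subset[OF compactly_supported_cutoff]) (simp add: multiplier_def)

lemma norm_\<xi>_mult_norm_cutoff_grad_le:
  "norm (\<xi> x) * norm (cutoff_grad x) \<le> gradient_bound * R * shell x"
proof (cases "shell x = 0")
  case False
  then have "norm (\<xi> x) \<le> R"
    by (intro norm_\<xi>_le less_imp_le shell_nonzeroD)
  then have "norm (\<xi> x) * norm (cutoff_grad x) \<le> R * (gradient_bound * shell x)"
    by (intro mult_mono norm_cutoff_grad_le R_nonneg) simp_all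
  then show ?thesis
    by (simp add: mult_ac)
qed (simp add: cutoff_grad_def)

lemma linear_trace_multiplier_deriv:
  "linear_trace (multiplier_deriv x) = DIM('a) * cutoff x + \<xi> x \<bullet> cutoff_grad x"
proof -
  have "linear (\<lambda>u. u \<bullet> cutoff_grad x)"
    by (intro bounded_linear.linear bounded_linear_inner_left)
  then show ?thesis
    by (simp add: multiplier_deriv_def[abs_def] linear_trace_add linear_trace_scaleR linear_trace_id
        linear_trace_rank_one)
qed

lemma multiplier_deriv_inner_ge:
  "cutoff x * (norm u)\<^sup>2 - gradient_bound * R * (shell x * (norm u)\<^sup>2) \<le> multiplier_deriv x u \<bullet> u"
proof -
  have "\<bar>(u \<bullet> cutoff_grad x) * (\<xi> x \<bullet> u)\<bar> \<le> (norm u * norm (cutoff_grad x)) * (norm (\<xi> x) * norm u)"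
    unfolding abs_mult by (intro mult_mono Cauchy_Schwarz_ineq2) simp_all
  also have "\<dots> = norm (\<xi> x) * norm (cutoff_grad x) * (norm u)\<^sup>2"
    by (simp add: power2_eq_square)
  also have "\<dots> \<le> gradient_bound * R * shell x * (norm u)\<^sup>2"
    by (intro mult_right_mono norm_\<xi>_mult_norm_cutoff_grad_le) simp
  finally show ?thesis
    by (simp add: multiplier_deriv_def inner_add_left power2_norm_eq_inner)
qed

lemma multiplier_inner_grad_le: "multiplier x \<bullet> grad v x \<le> c * v x"
proof (cases "v x \<le> b")
  case True
  have "cutoff x * (\<xi> x \<bullet> grad v x) \<le> cutoff x * (c * v x)"
    by (intro mult_left_mono virial_le True cutoff_nonneg)
  also have "\<dots> \<le> c * v x"
    by (intro mult_left_le_one_le mult_nonneg_nonneg c_nonneg v_nonneg cutoff_nonneg cutoff_le_1)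
  finally show ?thesis
    by (simp add: multiplier_def)
next
  case False
  then show ?thesis
    by (simp add: multiplier_def cutoff_eq_0 c_nonneg v_nonneg)
qed

end

locale eigenfunction_virial = eigenfunction v h E \<psi> + virial_field v \<xi> a b c D R
  for v :: "'a::euclidean_space \<Rightarrow> real" and h E \<psi> \<xi> a b c D R +
  assumes E_le_a: "E \<le> a"
begin

abbreviation U :: real where
  "U \<equiv> potential_energy v \<psi>"

lemmas integrable_cutoffs =
  integrable_compactly_supported_mult[OF compactly_supported_cutoff continuous_on_cutoff(1)]
  integrable_compactly_supported_mult[OF compactly_supported_shell continuous_on_cutoff(2)]

definition virial_weight :: "'a \<Rightarrow> real" where
  "virial_weight x = gradient_bound\<^sup>2 / a * (v x * (\<psi> x)\<^sup>2)"

lemma virial_weight_nonneg: "0 \<le> virial_weight x"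
  using v_nonneg a_pos by (simp add: virial_weight_def)

lemma integrable_virial_weight: "integrable lborel virial_weight"
  and integral_virial_weight: "(\<integral>x. virial_weight x \<partial>lborel) = gradient_bound\<^sup>2 / a * U"
  unfolding virial_weight_def potential_energy_def
  by (rule integrable_mult_right[OF integrable_potential] integral_mult_right_zero)+

lemma gradient_square_le_virial_weight:
  assumes "(norm g)\<^sup>2 \<le> gradient_bound\<^sup>2 * shell x"
  shows "(\<psi> x)\<^sup>2 * (norm g)\<^sup>2 \<le> shell x * virial_weight x"
proof (cases "shell x = 0")
  case False
  then have "a * (\<psi> x)\<^sup>2 \<le> v x * (\<psi> x)\<^sup>2"
    using shell_nonzeroD(1)[of x] by (intro mult_right_mono) simp_all
  then have weight: "gradient_bound\<^sup>2 / a * (a * (\<psi> x)\<^sup>2) \<le> virial_weight x"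
    unfolding virial_weight_def using a_pos by (intro mult_left_mono) simp_all
  have "(\<psi> x)\<^sup>2 * (norm g)\<^sup>2 \<le> (\<psi> x)\<^sup>2 * (gradient_bound\<^sup>2 * shell x)"
    by (intro mult_left_mono assms) simp
  also have "\<dots> = shell x * (gradient_bound\<^sup>2 / a * (a * (\<psi> x)\<^sup>2))"
    using a_pos by simp
  also have "\<dots> \<le> shell x * virial_weight x"
    by (intro mult_left_mono weight shell_nonneg)
  finally show ?thesis .
qed (use assms in simp)

lemma weighted_kinetic_shell_le: "weighted_kinetic shell \<le> h\<^sup>2 * (\<integral>x. virial_weight x \<partial>lborel)"
proof -
  have "weighted_kinetic shell / 2 + (\<integral>x. shell x * ((v x - E) * (\<psi> x)\<^sup>2) \<partial>lborel)
      \<le> h\<^sup>2 / 2 * (\<integral>x. virial_weight x \<partial>lborel)"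
    by (intro caccioppoli[OF compactly_supported_shell GDERIV_shell] continuous_on_cutoff
        shell_nonneg integrable_virial_weight virial_weight_nonneg
        gradient_square_le_virial_weight norm_shell_grad_square_le)
  moreover have "0 \<le> (\<integral>x. shell x * ((v x - E) * (\<psi> x)\<^sup>2) \<partial>lborel)"
  proof (intro Bochner_Integration.integral_nonneg)
    show "0 \<le> shell x * ((v x - E) * (\<psi> x)\<^sup>2)" for x
      using shell_nonneg[of x] shell_nonzeroD(1)[of x] E_le_a by (cases "shell x = 0") auto
  qed
  ultimately show ?thesis
    by simp
qed

lemma abs_weighted_energy_le_virial_weight:
  assumes "compactly_supported \<rho>" and "\<And>x. GDERIV \<rho> x :> \<rho>' x" and "continuous_on UNIV \<rho>'"
    and "\<And>x. (norm (\<rho>' x))\<^sup>2 \<le> gradient_bound\<^sup>2 * shell x"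
  shows "\<bar>weighted_energy \<rho>\<bar> \<le> h\<^sup>2 * (\<integral>x. virial_weight x \<partial>lborel)"
proof -
  have "\<bar>weighted_energy \<rho>\<bar> \<le> (weighted_kinetic shell + h\<^sup>2 * (\<integral>x. virial_weight x \<partial>lborel)) / 2"
    by (intro abs_weighted_energy_le[OF assms(1-3)] compactly_supported_shell continuous_on_cutoff
        shell_nonneg integrable_virial_weight virial_weight_nonneg
        gradient_square_le_virial_weight assms(4))
  then show ?thesis
    using weighted_kinetic_shell_le by simp
qed

lemma linear_trace_multiplier_deriv_mult_energy_density_le:
  "linear_trace (multiplier_deriv x) * energy_density x
    \<le> DIM('a) * (cutoff x * energy_density x) + gradient_bound * R * (shell x * energy_density x)"
proof -
  have "(\<xi> x \<bullet> cutoff_grad x) * energy_density x \<le> gradient_bound * R * shell x * energy_density x"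
  proof (cases "shell x = 0")
    case False
    then have "0 \<le> energy_density x"
      using shell_nonzeroD(1)[of x] E_le_a by (simp add: energy_density_def)
    moreover have "\<xi> x \<bullet> cutoff_grad x \<le> gradient_bound * R * shell x"
      using norm_cauchy_schwarz norm_\<xi>_mult_norm_cutoff_grad_le by (rule order_trans)
    ultimately show ?thesis
      by (rule mult_right_mono[rotated])
  qed (simp add: cutoff_grad_def)
  then show ?thesis
    by (simp add: linear_trace_multiplier_deriv distrib_right mult.assoc)
qed

lemmas multiplier_C1 =
  compactly_supported_multiplier has_derivative_multiplier continuous_on_multiplier_deriv

lemma multiplier_kinetic_ge:
  "weighted_kinetic cutoff - gradient_bound * R * weighted_kinetic shell
    \<le> h\<^sup>2 * (\<integral>x. multiplier_deriv x (grad \<psi> x) \<bullet> grad \<psi> x \<partial>lborel)"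
proof -
  have int: "integrable lborel (\<lambda>x. cutoff x * (norm (grad \<psi> x))\<^sup>2)"
    "integrable lborel (\<lambda>x. shell x * (norm (grad \<psi> x))\<^sup>2)"
    by (intro integrable_cutoffs continuous_intros)+
  then have "weighted_kinetic cutoff - gradient_bound * R * weighted_kinetic shell
      = h\<^sup>2 * (\<integral>x. cutoff x * (norm (grad \<psi> x))\<^sup>2
          - gradient_bound * R * (shell x * (norm (grad \<psi> x))\<^sup>2) \<partial>lborel)"
    by (simp add: weighted_kinetic_def algebra_simps)
  also have "\<dots> \<le> h\<^sup>2 * (\<integral>x. multiplier_deriv x (grad \<psi> x) \<bullet> grad \<psi> x \<partial>lborel)"
    by (intro mult_left_mono Bochner_Integration.integral_mono multiplier_deriv_inner_ge
        Bochner_Integration.integrable_diff integrable_mult_right int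
        integrable_virial_terms[OF multiplier_C1]) simp
  finally show ?thesis .
qed

lemma multiplier_divergence_le:
  "(\<integral>x. linear_trace (multiplier_deriv x) * energy_density x \<partial>lborel)
    \<le> DIM('a) * weighted_energy cutoff + gradient_bound * R * weighted_energy shell"
proof -
  have int: "integrable lborel (\<lambda>x. cutoff x * energy_density x)"
    "integrable lborel (\<lambda>x. shell x * energy_density x)"
    by (intro integrable_cutoffs continuous_intros)+
  have "(\<integral>x. linear_trace (multiplier_deriv x) * energy_density x \<partial>lborel)
      \<le> (\<integral>x. DIM('a) * (cutoff x * energy_density x)
          + gradient_bound * R * (shell x * energy_density x) \<partial>lborel)"
    by (intro Bochner_Integration.integral_mono Bochner_Integration.integrable_add
        integrable_mult_right int linear_trace_multiplier_deriv_mult_energy_density_le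
        integrable_virial_terms[OF multiplier_C1])
  also have "\<dots> = DIM('a) * weighted_energy cutoff + gradient_bound * R * weighted_energy shell"
    using int by (simp add: weighted_energy_def)
  finally show ?thesis .
qed

lemma multiplier_force_le: "(\<integral>x. (multiplier x \<bullet> grad v x) * (\<psi> x)\<^sup>2 \<partial>lborel) \<le> c * U"
proof -
  have "(multiplier x \<bullet> grad v x) * (\<psi> x)\<^sup>2 \<le> c * (v x * (\<psi> x)\<^sup>2)" for x
    using mult_right_mono[OF multiplier_inner_grad_le, of "(\<psi> x)\<^sup>2" x] by (simp add: mult.assoc)
  then have "(\<integral>x. (multiplier x \<bullet> grad v x) * (\<psi> x)\<^sup>2 \<partial>lborel) \<le> (\<integral>x. c * (v x * (\<psi> x)\<^sup>2) \<partial>lborel)"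
    by (intro Bochner_Integration.integral_mono integrable_virial_terms[OF multiplier_C1]
        integrable_mult_right integrable_potential)
  then show ?thesis
    by (simp add: potential_energy_def)
qed

lemma weighted_kinetic_cutoff_le:
  "2 * weighted_kinetic cutoff \<le> c * U + DIM('a) * weighted_energy cutoff
    + gradient_bound * R * (weighted_energy shell + 2 * weighted_kinetic shell)"
  using multiplier_kinetic_ge multiplier_divergence_le multiplier_force_le
    virial_identity[OF multiplier_C1]
  by (simp add: algebra_simps)

lemma eigenvalue_minus_potential_energy_le:
  "E - U \<le> weighted_kinetic cutoff - weighted_energy cutoff"
proof -
  have int: "integrable lborel (\<lambda>x. cutoff x * ((v x - E) * (\<psi> x)\<^sup>2))"
    by (intro integrable_cutoffs continuous_intros)
  have "(\<integral>x. cutoff x * ((v x - E) * (\<psi> x)\<^sup>2) \<partial>lborel) \<le> (\<integral>x. v x * (\<psi> x)\<^sup>2 - E * (\<psi> x)\<^sup>2 \<partial>lborel)"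
  proof (intro Bochner_Integration.integral_mono int Bochner_Integration.integrable_diff
      integrable_mult_right integrable_square integrable_potential)
    fix x
    have "0 \<le> (1 - cutoff x) * (v x - E)"
      using cutoff_le_1[of x] cutoff_eq_1[of x] E_le_a by (cases "v x \<le> a") auto
    then have "0 \<le> (1 - cutoff x) * (v x - E) * (\<psi> x)\<^sup>2"
      by simp
    then show "cutoff x * ((v x - E) * (\<psi> x)\<^sup>2) \<le> v x * (\<psi> x)\<^sup>2 - E * (\<psi> x)\<^sup>2"
      by (simp add: algebra_simps)
  qed
  also have "\<dots> = U - E"
    using integrable_square integrable_potential integral_square by (simp add: potential_energy_def)
  finally show ?thesis
    by (simp add: weighted_energy_eq[OF compactly_supported_cutoff continuous_on_cutoff(1)])
qed

theorem eigenvalue_le_potential_energy: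
  "2 * E \<le> (2 + c + h\<^sup>2 * ((DIM('a) + 2 + 3 * (gradient_bound * R)) * (gradient_bound\<^sup>2 / a))) * U"
proof -
  define \<beta> where "\<beta> = gradient_bound * R"
  define \<mu> where "\<mu> = h\<^sup>2 * (\<integral>x. virial_weight x \<partial>lborel)"
  have "0 \<le> \<beta>"
    using gradient_bound_nonneg R_nonneg by (simp add: \<beta>_def)
  have cutoff_le: "\<bar>weighted_energy cutoff\<bar> \<le> \<mu>"
    unfolding \<mu>_def
    by (rule abs_weighted_energy_le_virial_weight[OF compactly_supported_cutoff GDERIV_cutoff
          continuous_on_cutoff(3) norm_cutoff_grad_square_le])
  have shell_le: "\<bar>weighted_energy shell\<bar> \<le> \<mu>"
    unfolding \<mu>_def
    by (rule abs_weighted_energy_le_virial_weight[OF compactly_supported_shell GDERIV_shell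
          continuous_on_cutoff(4) norm_shell_grad_square_le])
  have "2 * (E - U) \<le> c * U + (real DIM('a) - 2) * weighted_energy cutoff
      + \<beta> * (weighted_energy shell + 2 * weighted_kinetic shell)"
    using weighted_kinetic_cutoff_le eigenvalue_minus_potential_energy_le
    by (simp add: \<beta>_def left_diff_distrib)
  also have "\<dots> \<le> c * U + (DIM('a) + 2) * \<mu> + \<beta> * (3 * \<mu>)"
  proof (intro add_mono order_refl mult_left_mono \<open>0 \<le> \<beta>\<close>)
    have "(real DIM('a) - 2) * weighted_energy cutoff
        \<le> \<bar>real DIM('a) - 2\<bar> * \<bar>weighted_energy cutoff\<bar>"
      by (metis abs_ge_self abs_mult)
    also have "\<dots> \<le> (DIM('a) + 2) * \<mu>"
      by (intro mult_mono cutoff_le) auto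
    finally show "(real DIM('a) - 2) * weighted_energy cutoff \<le> (DIM('a) + 2) * \<mu>" .
    show "weighted_energy shell + 2 * weighted_kinetic shell \<le> 3 * \<mu>"
      using abs_le_D1[OF shell_le] weighted_kinetic_shell_le by (simp add: \<mu>_def)
  qed
  also have "\<dots> = c * U + h\<^sup>2 * ((DIM('a) + 2 + 3 * \<beta>) * (gradient_bound\<^sup>2 / a)) * U"
    unfolding \<mu>_def integral_virial_weight by (simp add: algebra_simps add_divide_distrib)
  finally show ?thesis
    unfolding \<beta>_def by (simp add: distrib_right)
qed

end

lemma (in potential) exists_virial_constant:
  assumes "0 < a" "a < b" "0 \<le> c" and compact: "compact {x. v x \<le> b}"
    and \<xi>: "\<And>x. v x \<le> b \<Longrightarrow> (\<xi> has_derivative (\<lambda>u. u)) (at x)"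
    and virial: "\<And>x. v x \<le> b \<Longrightarrow> \<xi> x \<bullet> grad v x \<le> c * v x"
  obtains C where "\<And>h E \<psi>. E \<le> a \<Longrightarrow> normalized_eigenfunction v h E \<psi>
    \<Longrightarrow> 2 * E \<le> (2 + c + h\<^sup>2 * C) * potential_energy v \<psi>"
proof -
  have "continuous_on {x. v x \<le> b} \<xi>"
    by (rule has_derivative_continuous_on[OF has_derivative_at_withinI[OF \<xi>]]) simp
  then have "bounded (\<xi> ` {x. v x \<le> b})"
    by (intro compact_imp_bounded compact_continuous_image compact)
  then obtain R where R: "0 < R" "\<And>x. v x \<le> b \<Longrightarrow> norm (\<xi> x) \<le> R"
    unfolding bounded_pos by blast
  have "bounded (grad v ` {x. v x \<le> b})"
    by (intro compact_imp_bounded compact_continuous_image compact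
        continuous_on_subset[OF continuous_on_v(2)] subset_UNIV)
  then obtain D where D: "0 < D" "\<And>x. v x \<le> b \<Longrightarrow> norm (grad v x) \<le> D"
    unfolding bounded_pos by blast
  interpret virial_field v \<xi> a b c D R
    by unfold_locales (use assms D R in auto)
  show ?thesis
  proof (rule that)
    fix h E \<psi> assume "E \<le> a" "normalized_eigenfunction v h E \<psi>"
    then interpret eigenfunction_virial v h E \<psi> \<xi> a b c D R
      by unfold_locales
    show "2 * E \<le> (2 + c
        + h\<^sup>2 * ((DIM('a) + 2 + 3 * (gradient_bound * R)) * (gradient_bound\<^sup>2 / a))) * U"
      by (rule eigenvalue_le_potential_energy)
  qed
qed

section \<open>The virial condition slightly above the energy\<close>

lemma compact_sublevel_less_v_infty:
  fixes v :: "'a::euclidean_space \<Rightarrow> real"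
  assumes "continuous_on UNIV v" and "ereal L < v_infty v"
  shows "compact {x. v x \<le> L}"
proof -
  have "eventually (\<lambda>x. ereal L < ereal (v x)) at_infinity"
    using assms(2) unfolding v_infty_def by (rule less_LiminfD)
  then obtain r where "\<And>x. r \<le> norm x \<Longrightarrow> L < v x"
    unfolding eventually_at_infinity by auto
  then have "{x. v x \<le> L} \<subseteq> cball 0 r"
    by (force simp: not_le[symmetric])
  moreover have "closed {x. v x \<le> L}"
    by (intro closed_Collect_le assms continuous_intros)
  ultimately show ?thesis
    using bounded_subset[OF bounded_cball] compact_eq_bounded_closed by blast
qed

lemma sublevel_subset_open_extends:
  fixes v :: "'a::euclidean_space \<Rightarrow> real"
  assumes v: "continuous_on UNIV v" "ereal e < v_infty v" and S: "open S" "{x. v x \<le> e} \<subseteq> S"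
  obtains b where "e < b" "compact {x. v x \<le> b}" "{x. v x \<le> b} \<subseteq> S"
proof -
  obtain L where L: "e < L" "ereal L < v_infty v"
    using ereal_dense2[OF v(2)] by auto
  have compact_L: "compact {x. v x \<le> L}"
    by (rule compact_sublevel_less_v_infty[OF v(1) L(2)])
  show ?thesis
  proof (cases "{x. v x \<le> L} \<subseteq> S")
    case True
    with L(1) compact_L show ?thesis
      by (rule that[of L])
  next
    case False
    have "compact ({x. v x \<le> L} - S)"
      by (rule compact_diff[OF compact_L S(1)])
    then obtain y where y: "v y \<le> L" "y \<notin> S" and y_min: "\<And>x. v x \<le> L \<Longrightarrow> x \<notin> S \<Longrightarrow> v y \<le> v x"
      using continuous_attains_inf[of "{x. v x \<le> L} - S" v] False
        continuous_on_subset[OF v(1) subset_UNIV] by blast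
    then have "e < v y"
      using S(2) by force
    define b where "b = (e + v y) / 2"
    have b: "e < b" "b < v y" "b \<le> L"
      using \<open>e < v y\<close> y(1) by (simp_all add: b_def)
    have "ereal b < v_infty v"
      using b(3) L(2) by (simp add: le_less_trans[of _ "ereal L"])
    then have "compact {x. v x \<le> b}"
      by (rule compact_sublevel_less_v_infty[OF v(1)])
    moreover have "{x. v x \<le> b} \<subseteq> S"
      using y_min b by force
    ultimately show ?thesis
      by (rule that[OF b(1)])
  qed
qed

lemma noncritical_level_subset_closure:
  assumes v: "v differentiable (at x)" and "noncritical v e" "v x = e"
  shows "x \<in> closure (sublevel v e)"
proof -
  define u where "u = - grad v x"
  have "((\<lambda>t. v (x + t *\<^sub>R u)) has_real_derivative u \<bullet> grad v x) (at 0)"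
    using GDERIV_grad[OF v] by (intro has_real_derivative_along_line) (simp add: gderiv_def)
  moreover have "u \<bullet> grad v x < 0"
    using assms(2,3) by (simp add: u_def noncritical_def)
  ultimately obtain d where "0 < d" and d: "\<And>t. 0 < t \<Longrightarrow> t < d \<Longrightarrow> v (x + t *\<^sub>R u) < e"
    using DERIV_neg_dec_right[of "\<lambda>t. v (x + t *\<^sub>R u)" "u \<bullet> grad v x" 0] assms(3) by auto
  have "((\<lambda>t. x + t *\<^sub>R u) \<longlongrightarrow> x + 0 *\<^sub>R u) (at_right 0)"
    by (intro tendsto_intros)
  moreover have "eventually (\<lambda>t. x + t *\<^sub>R u \<in> sublevel v e) (at_right 0)"
    using \<open>0 < d\<close> d by (auto simp: sublevel_def eventually_at_right_field)
  ultimately have "x + 0 *\<^sub>R u \<in> closure (sublevel v e)"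
    by (intro Lim_in_closed_set[OF closed_closure])
       (auto elim: eventually_mono intro: closure_subset[THEN subsetD])
  then show ?thesis
    by simp
qed

lemma (in potential) open_sublevel: "open (sublevel v e)"
  unfolding sublevel_def by (intro open_Collect_less continuous_intros)

lemma (in potential) nonpos_on_noncritical_level:
  assumes "noncritical v e" and "0 < \<epsilon>" and k: "continuous_on (sublevel v (e + \<epsilon>)) k"
    and nonpos: "\<And>x. x \<in> sublevel v e \<Longrightarrow> k x \<le> 0" and "v x = e"
  shows "k x \<le> (0::real)"
proof (rule continuous_le_on_closure[where f = k and S = "sublevel v e"])
  show "x \<in> closure (sublevel v e)"
    using v_C1 assms(1,5)
    by (intro noncritical_level_subset_closure) (simp_all add: differentiable_on_def)
  have "closure (sublevel v e) \<subseteq> {x. v x \<le> e}"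
    by (intro closure_minimal closed_Collect_le continuous_intros) (auto simp: sublevel_def)
  then show "continuous_on (closure (sublevel v e)) k"
    by (rule continuous_on_subset[OF k, OF subset_trans]) (use \<open>0 < \<epsilon>\<close> in \<open>auto simp: sublevel_def\<close>)
qed (rule nonpos)

lemma (in potential) virial_condition_extends:
  assumes "noncritical v e" "ereal e < v_infty v" and pos: "0 < e" "0 < \<epsilon>" "0 < \<gamma>"
    and \<xi>_cont: "continuous_on (sublevel v (e + \<epsilon>)) \<xi>"
    and virial: "\<And>x. x \<in> sublevel v e \<Longrightarrow> \<xi> x \<bullet> grad v x \<le> c * v x"
  obtains b where "e < b" "compact {x. v x \<le> b}" "{x. v x \<le> b} \<subseteq> sublevel v (e + \<epsilon>)"
    "\<And>x. v x \<le> b \<Longrightarrow> \<xi> x \<bullet> grad v x \<le> (c + \<gamma>) * v x"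
proof -
  define k where "k x = \<xi> x \<bullet> grad v x - c * v x" for x
  define S where "S = sublevel v e \<union> sublevel v (e + \<epsilon>) \<inter> (\<lambda>x. k x - \<gamma> * v x) -` {..<0}"
  have k_cont: "continuous_on (sublevel v (e + \<epsilon>)) k"
    unfolding k_def
    by (intro continuous_intros \<xi>_cont continuous_on_subset[OF continuous_on_v(1)]
        continuous_on_subset[OF continuous_on_v(2)] subset_UNIV)
  have "open S"
    unfolding S_def
    by (intro open_Un open_sublevel continuous_open_preimage continuous_intros k_cont
        continuous_on_subset[OF continuous_on_v(1)] subset_UNIV open_lessThan)
  have "k x - \<gamma> * v x < 0" if "v x = e" for x
  proof -
    have "k x \<le> 0"
      by (rule nonpos_on_noncritical_level[OF assms(1) pos(2) k_cont _ that])
         (simp add: k_def virial)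
    then show ?thesis
      using mult_pos_pos[OF pos(3,1)] that by simp
  qed
  then have "{x. v x \<le> e} \<subseteq> S"
    using pos(2) by (auto simp: S_def sublevel_def le_less)
  then obtain b where b: "e < b" "compact {x. v x \<le> b}" "{x. v x \<le> b} \<subseteq> S"
    using sublevel_subset_open_extends[OF continuous_on_v(1) assms(2) \<open>open S\<close>] by metis
  show ?thesis
  proof (rule that[OF b(1,2)])
    show "{x. v x \<le> b} \<subseteq> sublevel v (e + \<epsilon>)"
      using b(3) pos(2) by (auto simp: S_def sublevel_def)
    show "\<xi> x \<bullet> grad v x \<le> (c + \<gamma>) * v x" if "v x \<le> b" for x
    proof (cases "x \<in> sublevel v e")
      case True
      moreover have "0 \<le> \<gamma> * v x"
        using pos(3) v_nonneg[of x] by simp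
      ultimately show ?thesis
        using virial[of x] by (simp add: distrib_right)
    next
      case False
      then have "k x - \<gamma> * v x < 0"
        using that b(3) by (auto simp: S_def)
      then show ?thesis
        by (simp add: k_def distrib_right)
    qed
  qed
qed

section \<open>Eigenvalues and potential energy\<close>

lemma (in potential) eigenvalue_le_potential_energy_near:
  assumes v: "noncritical v e" "ereal e < v_infty v"
    and pos: "0 < e" "0 < \<epsilon>" "0 < \<gamma>" "0 \<le> c"
    and \<xi>: "\<And>x. x \<in> sublevel v (e + \<epsilon>) \<Longrightarrow> (\<xi> has_derivative (\<lambda>u. u)) (at x)"
    and virial: "\<And>x. x \<in> sublevel v e \<Longrightarrow> \<xi> x \<bullet> grad v x \<le> c * v x"
  obtains \<delta> C where "0 < \<delta>" "\<And>h E \<psi>. E \<le> e + \<delta> \<Longrightarrow> normalized_eigenfunction v h E \<psi>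
    \<Longrightarrow> 2 * E \<le> (2 + (c + \<gamma>) + h\<^sup>2 * C) * potential_energy v \<psi>"
proof -
  have "continuous_on (sublevel v (e + \<epsilon>)) \<xi>"
    by (rule has_derivative_continuous_on[OF has_derivative_at_withinI[OF \<xi>]])
  with virial obtain b where b: "e < b" "compact {x. v x \<le> b}" "{x. v x \<le> b} \<subseteq> sublevel v (e + \<epsilon>)"
    "\<And>x. v x \<le> b \<Longrightarrow> \<xi> x \<bullet> grad v x \<le> (c + \<gamma>) * v x"
    using virial_condition_extends[OF v pos(1-3)] by metis
  have \<xi>_b: "(\<xi> has_derivative (\<lambda>u. u)) (at x)" if "v x \<le> b" for x
    using that b(3) by (intro \<xi>) auto
  define \<delta> where "\<delta> = (b - e) / 2"
  have \<delta>: "0 < \<delta>" "0 < e + \<delta>" "e + \<delta> < b" "0 \<le> c + \<gamma>"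
    using b(1) pos by (simp_all add: \<delta>_def field_simps)
  show ?thesis
    using exists_virial_constant[OF \<delta>(2-4) b(2) \<xi>_b b(4)] that[OF \<delta>(1)] by blast
qed

lemma (in potential) eigenvalue_le_potential_energy_small_h:
  assumes v: "noncritical v e" "ereal e < v_infty v" and pos: "0 < e" "0 < \<epsilon>" "0 \<le> c"
    and \<xi>: "\<And>x. x \<in> sublevel v (e + \<epsilon>) \<Longrightarrow> (\<xi> has_derivative (\<lambda>u. u)) (at x)"
    and virial: "\<And>x. x \<in> sublevel v e \<Longrightarrow> \<xi> x \<bullet> grad v x \<le> c * v x"
    and "c + 2 < m"
  obtains \<delta> h\<^sub>0 where "0 < \<delta>" "0 < h\<^sub>0" "\<And>h E \<psi>. 0 < h \<Longrightarrow> h < h\<^sub>0 \<Longrightarrow> E < e + \<delta>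
    \<Longrightarrow> normalized_eigenfunction v h E \<psi> \<Longrightarrow> 2 * E \<le> m * potential_energy v \<psi>"
proof -
  define \<gamma> where "\<gamma> = (m - (c + 2)) / 2"
  have \<gamma>: "0 < \<gamma>" "m = 2 + c + 2 * \<gamma>"
    using \<open>c + 2 < m\<close> by (simp_all add: \<gamma>_def field_simps)
  obtain \<delta> C where "0 < \<delta>" and C: "\<And>h E \<psi>. E \<le> e + \<delta> \<Longrightarrow> normalized_eigenfunction v h E \<psi>
      \<Longrightarrow> 2 * E \<le> (2 + (c + \<gamma>) + h\<^sup>2 * C) * potential_energy v \<psi>"
    using eigenvalue_le_potential_energy_near[OF v pos(1,2) \<gamma>(1) pos(3) \<xi> virial] by metis
  define h\<^sub>0 where "h\<^sub>0 = sqrt (\<gamma> / (\<bar>C\<bar> + 1))"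
  show ?thesis
  proof
    show "0 < \<delta>" "0 < h\<^sub>0"
      using \<open>0 < \<delta>\<close> \<gamma>(1) by (simp_all add: h\<^sub>0_def)
    fix h E \<psi> assume h: "0 < h" "h < h\<^sub>0" and E: "E < e + \<delta>" "normalized_eigenfunction v h E \<psi>"
    have "h\<^sup>2 \<le> h\<^sub>0\<^sup>2"
      using h by (intro power_mono) simp_all
    then have "h\<^sup>2 * (\<bar>C\<bar> + 1) \<le> \<gamma>"
      using \<gamma>(1) by (simp add: h\<^sub>0_def field_simps)
    moreover have "h\<^sup>2 * C \<le> h\<^sup>2 * (\<bar>C\<bar> + 1)"
      by (intro mult_left_mono) simp_all
    ultimately have "(2 + (c + \<gamma>) + h\<^sup>2 * C) * potential_energy v \<psi> \<le> m * potential_energy v \<psi>"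
      unfolding \<gamma>(2) by (intro mult_right_mono potential_energy_nonneg) simp
    with C[OF less_imp_le[OF E(1)] E(2)] show "2 * E \<le> m * potential_energy v \<psi>"
      by simp
  qed
qed

lemma mult_eigenvalue_le:
  fixes E U c m :: real
  assumes "0 \<le> U" "U \<le> E" "2 * E \<le> m * U" "c * m \<le> 2"
  shows "c * E \<le> U"
proof (cases "c \<le> 0")
  case True
  then have "c * E \<le> 0"
    using assms(1,2) by (intro mult_nonpos_nonneg) simp_all
  then show ?thesis
    using assms(1) by simp
next
  case False
  then have "c * (2 * E) \<le> c * (m * U)"
    by (intro mult_left_mono assms(3)) simp
  also have "\<dots> \<le> 2 * U"
    using mult_right_mono[OF assms(4,1)] by simp
  finally show ?thesis
    by simp
qed

lemma exists_factor_le_2: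
  fixes c m\<^sub>0 :: real
  assumes "0 < m\<^sub>0" "c < 2 / m\<^sub>0"
  obtains m where "m\<^sub>0 < m" "c * m \<le> 2"
proof (cases "c \<le> 0")
  case True
  then have "c * (m\<^sub>0 + 1) \<le> 0"
    using assms(1) by (intro mult_nonpos_nonneg) simp_all
  then show ?thesis
    by (intro that[of "m\<^sub>0 + 1"]) simp_all
next
  case False
  then show ?thesis
    using assms by (intro that[of "2 / c"]) (simp_all add: field_simps)
qed

theorem (in potential) potential_energy_ge_eigenvalue:
  assumes v: "noncritical v e" "ereal e < v_infty v" and pos: "0 < e" "0 < \<epsilon>" "0 \<le> c"
    and \<xi>: "\<And>x. x \<in> sublevel v (e + \<epsilon>) \<Longrightarrow> (\<xi> has_derivative (\<lambda>u. u)) (at x)"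
    and virial: "\<And>x. x \<in> sublevel v e \<Longrightarrow> \<xi> x \<bullet> grad v x \<le> c * v x"
    and k: "k < 2 / (c + 2)"
  obtains \<delta> h\<^sub>0 where "0 < \<delta>" "0 < h\<^sub>0" "\<And>h E \<psi>. 0 < h \<Longrightarrow> h < h\<^sub>0 \<Longrightarrow> E < e + \<delta>
    \<Longrightarrow> normalized_eigenfunction v h E \<psi> \<Longrightarrow> k * E \<le> potential_energy v \<psi>"
proof -
  obtain m where m: "c + 2 < m" "k * m \<le> 2"
    by (rule exists_factor_le_2[OF _ k]) (use pos(3) in simp)
  obtain \<delta> h\<^sub>0 where "0 < \<delta>" "0 < h\<^sub>0" and bound: "\<And>h E \<psi>. 0 < h \<Longrightarrow> h < h\<^sub>0 \<Longrightarrow> E < e + \<delta>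
      \<Longrightarrow> normalized_eigenfunction v h E \<psi> \<Longrightarrow> 2 * E \<le> m * potential_energy v \<psi>"
    using eigenvalue_le_potential_energy_small_h[OF v pos \<xi> virial m(1)] by metis
  show ?thesis
  proof (rule that[OF \<open>0 < \<delta>\<close> \<open>0 < h\<^sub>0\<close>])
    fix h E \<psi> assume h: "0 < h" "h < h\<^sub>0" and E: "E < e + \<delta>" "normalized_eigenfunction v h E \<psi>"
    interpret eigenfunction v h E \<psi>
      using E(2) by unfold_locales
    show "k * E \<le> potential_energy v \<psi>"
      using potential_energy_nonneg potential_energy_le_eigenvalue bound[OF h E] m(2)
      by (rule mult_eigenvalue_le)
  qed
qed

lemma exists_well_centred_field:
  fixes W :: "'i \<Rightarrow> 'a::real_normed_vector set" and p :: "'i \<Rightarrow> 'a"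
  assumes "disjoint_family_on W I" and "\<And>i. i \<in> I \<Longrightarrow> open (W i)"
  obtains \<xi> :: "'a \<Rightarrow> 'a" where "\<And>i x. i \<in> I \<Longrightarrow> x \<in> W i \<Longrightarrow> \<xi> x = x - p i"
    and "\<And>x. x \<in> (\<Union>i\<in>I. W i) \<Longrightarrow> (\<xi> has_derivative (\<lambda>u. u)) (at x)"
proof -
  define \<xi> where "\<xi> x = x - p (THE i. i \<in> I \<and> x \<in> W i)" for x
  have \<xi>: "\<xi> x = x - p i" if "i \<in> I" "x \<in> W i" for i x
  proof -
    have "(THE i. i \<in> I \<and> x \<in> W i) = i"
      using assms(1) that by (intro the_equality) (auto simp: disjoint_family_on_def)
    then show ?thesis
      by (simp add: \<xi>_def)
  qed
  moreover have "(\<xi> has_derivative (\<lambda>u. u)) (at x)" if "x \<in> (\<Union>i\<in>I. W i)" for x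
  proof -
    obtain i where i: "i \<in> I" "x \<in> W i"
      using \<open>x \<in> (\<Union>i\<in>I. W i)\<close> by blast
    have "((\<lambda>x. x - p i) has_derivative (\<lambda>u. u)) (at x)"
      by (auto intro!: derivative_eq_intros)
    then show ?thesis
      by (rule has_derivative_transform_within_open[OF _ assms(2)]) (use i \<xi> in auto)
  qed
  ultimately show ?thesis
    by (rule that)
qed

theorem proposition3p7:
  fixes v :: "real ^ 'd \<Rightarrow> real"
    and E\<^sub>0 \<epsilon>\<^sub>0 c\<^sub>0 :: real
    and N :: nat
    and W :: "nat \<Rightarrow> (real ^ 'd) set"
    and p :: "nat \<Rightarrow> real ^ 'd"
  assumes "C_infinity v"
    and "\<forall>x. 0 \<le> v x" and "\<exists>x. v x = 0"
    and "0 < v_infty v"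
    and "0 < E\<^sub>0" and "ereal E\<^sub>0 < v_infty v"
    and "noncritical v E\<^sub>0"
    and "0 < \<epsilon>\<^sub>0"
    and "sublevel v (E\<^sub>0 + \<epsilon>\<^sub>0) = (\<Union>n\<in>{1..N}. W n)"
    and "\<forall>n\<in>{1..N}. open (W n)"
    and "\<forall>n\<in>{1..N}. \<forall>m\<in>{1..N}. n \<noteq> m \<longrightarrow> W n \<inter> W m = {}"
    and "0 < c\<^sub>0"
    and "\<forall>n\<in>{1..N}. p n \<in> sublevel v E\<^sub>0 \<inter> W n"
    and "\<forall>n\<in>{1..N}. \<forall>x\<in>sublevel v E\<^sub>0 \<inter> W n. (x - p n) \<bullet> grad v x \<le> c\<^sub>0 * v x"
  shows "\<forall>c < 2 / (c\<^sub>0 + 2). \<exists>\<epsilon>>0. \<exists>h\<^sub>0>0. \<forall>h E \<psi>.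
           0 < h \<and> h < h\<^sub>0 \<and> E \<in> {E\<^sub>0 - \<epsilon>\<^sub>0 / 2 <..< E\<^sub>0 + \<epsilon>\<^sub>0 / 2} \<and> E < E\<^sub>0 + \<epsilon> \<and>
           normalized_eigenfunction v h E \<psi> \<longrightarrow>
           potential_energy v \<psi> \<ge> c * E"
proof (intro allI impI)
  fix c assume c: "c < 2 / (c\<^sub>0 + 2)"
  interpret potential v
    using assms(1,2) by unfold_locales (simp_all add: C_infinity_def del: C_k.simps)
  obtain \<xi> where \<xi>: "\<And>n x. n \<in> {1..N} \<Longrightarrow> x \<in> W n \<Longrightarrow> \<xi> x = x - p n"
    and \<xi>_deriv: "\<And>x. x \<in> sublevel v (E\<^sub>0 + \<epsilon>\<^sub>0) \<Longrightarrow> (\<xi> has_derivative (\<lambda>u. u)) (at x)"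
    using exists_well_centred_field[of W "{1..N}" p] assms(9-11)
    by (auto simp: disjoint_family_on_def)
  have virial: "\<xi> x \<bullet> grad v x \<le> c\<^sub>0 * v x" if "x \<in> sublevel v E\<^sub>0" for x
  proof -
    have "x \<in> sublevel v (E\<^sub>0 + \<epsilon>\<^sub>0)"
      using that assms(8) by (simp add: sublevel_def)
    with assms(9,14) that \<xi> show ?thesis
      by auto
  qed
  show "\<exists>\<epsilon>>0. \<exists>h\<^sub>0>0. \<forall>h E \<psi>.
      0 < h \<and> h < h\<^sub>0 \<and> E \<in> {E\<^sub>0 - \<epsilon>\<^sub>0 / 2 <..< E\<^sub>0 + \<epsilon>\<^sub>0 / 2} \<and> E < E\<^sub>0 + \<epsilon> \<and>
      normalized_eigenfunction v h E \<psi> \<longrightarrow> potential_energy v \<psi> \<ge> c * E"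
    using potential_energy_ge_eigenvalue
      [OF assms(7,6,5,8) less_imp_le[OF assms(12)] \<xi>_deriv virial c] by metis
qed

end
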